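(* Let $n\in\{0,1,2\}$, $\gamma>1$, $\gamma_*=\frac{n+3}{n+1}$, and let $S=S(s)$ be an arbitrary function. Consider the Lagrangian $$L=\tfrac12\varphi_t^2-\frac{S(s)}{\gamma-1}\varphi^{n(1-\gamma)}\varphi_s^{1-\gamma}$$ and its Euler–Lagrange equation $(\ast)$ for $\varphi(t,s)$. For arbitrary $S(s)$ the point symmetries admitted by $(\ast)$ are $X_1=\partial_t$ and $X_2=((n+1)\gamma-n+1)\,t\,\partial_t+2\varphi\,\partial_\varphi$; for $n=0$ additionally $\partial_\varphi$ and $t\,\partial_\varphi$; for $\gamma=\gamma_*$ additionally $t^2\partial_t+t\varphi\,\partial_\varphi$. They yield the following Noether symmetries and conservation laws $D_tT^t+D_sT^s=0$. (1) General case $n\neq0$, $\gamma\neq\gamma_*$: the admitted symmetries provide one variational symmetry $Z_1=\partial_t$, which leads to the conservation of energy with densities $$T^t=\frac{\varphi_t^2}{2}+\frac{S}{\gamma-1}\varphi^{n(1-\gamma)}\varphi_s^{1-\gamma},\qquad T^s=\varphi_t\,S\,\varphi^{n(1-\gamma)}\varphi_s^{-\gamma}.$$ (2) Case $n=0$, $\gamma\neq\gamma_*$: there is one more variational symmetry $\partial_\varphi$ and one divergent symmetry $t\,\partial_\varphi$ with $(B_1,B_2)=(\varphi,0)$. These symmetries provide the conservation laws with densities $$T^t=\frac{\varphi_t^2}{2}+\frac{S}{\gamma-1}\varphi_s^{1-\gamma},\qquad T^s=S\varphi_t\varphi_s^{-\gamma};$$ $$T^t=\varphi-t\varphi_t,\qquad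 T^s=-tS\varphi_s^{-\gamma},$$ representing the conservation of momentum and the motion of the center of mass, respectively. (3) Case $n\neq0$, $\gamma=\gamma_*$: there are two variational symmetries, $Z_1=\partial_t$ and $\tfrac12X_2=2t\,\partial_t+\varphi\,\partial_\varphi$, and one divergent symmetry $t^2\partial_t+t\varphi\,\partial_\varphi$ with $(B_1,B_2)=(\varphi^2/2,0)$. In addition to the conservation of energy in (1), there are the conservation laws with densities $$T^t=2t\Big(-\frac{\varphi_t^2}{2}-\frac{S}{\gamma-1}\varphi^{n(1-\gamma)}\varphi_s^{1-\gamma}\Big)+\varphi\varphi_t,\qquad T^s=-2tS\varphi^{n(1-\gamma)}\varphi_t\varphi_s^{-\gamma}+S\varphi^{-n\gamma+n+1}\varphi_s^{-\gamma};$$ $$T^t=-t^2\Big(\frac{\varphi_t^2}{2}+\frac{S}{\gamma-1}\varphi^{n(1-\gamma)}\varphi_s^{1-\gamma}\Big)+t\varphi\varphi_t-\frac{\varphi^2}{2},\qquad T^s=-t^2S\varphi^{n(1-\gamma)}\varphi_t\varphi_s^{-\gamma}+tS\varphi^{-n\gamma+n+1}\varphi_s^{-\gamma}.$$ (4) Case $n=0$, $\gamma=\gamma_*=3$: the conservation law of the general case (1) is extended both by the conservation laws given in (2) and by those given in (3).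
   Context: Equation $(\ast)$ is explicitly $\varphi_{tt}+\varphi^{n(1-\gamma)}\varphi_s^{-\gamma}\big(S'-n\gamma S\frac{\varphi_s}{\varphi}-\gamma S\frac{\varphi_{ss}}{\varphi_s}\big)=0$; it describes one-dimensional flows of a polytropic gas in mass Lagrangian coordinates $(t,s)$ (plane flows for $n=0$, radially symmetric two-dimensional flows for $n=1$, spherically symmetric three-dimensional flows for $n=2$), where $S$ is a function of the entropy. $D_t,D_s$ are total derivatives, and conservation laws hold on solutions of $(\ast)$. A point vector field $X=\xi^t\partial_t+\xi^s\partial_s+\eta^\varphi\partial_\varphi$ with coefficients depending on $(t,s,\varphi)$, prolonged to first derivatives, is a Noether symmetry of $L$ if $XL+L(D_t\xi^t+D_s\xi^s)=D_tB_1+D_sB_2$ for some functions $B_1,B_2$ of $(t,s,\varphi)$; it is called variational if this holds with $B_1=B_2=0$, and divergent otherwise.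
   Formalization: In (2) and (4) the first displayed pair of (2) is the energy law generated by ∂_t, not the momentum law of ∂_φ; the formal text proves it as such and adds the true momentum law T^t=φ_t, T^s=Sφ_s^{-γ} for ∂_φ. S is taken to be C². *)

theory Defs
  imports "HOL-Analysis.Analysis"
begin

section \<open>Regularity\<close>

text \<open>In finite dimension, continuity of all directional derivatives is continuity of the
  Frechet derivative, so on an open set \<open>Ck_on k\<close> is the usual class \<open>C\<^sup>k\<close>.\<close>

primrec Ck_on :: "nat \<Rightarrow> 'a::real_normed_vector set \<Rightarrow> ('a \<Rightarrow> 'b::real_normed_vector) \<Rightarrow> bool" where
  "Ck_on 0 D f \<longleftrightarrow> continuous_on D f"
| "Ck_on (Suc k) D f \<longleftrightarrow>
     (\<forall>z\<in>D. f differentiable (at z)) \<and> (\<forall>v. Ck_on k D (\<lambda>z. frechet_derivative f (at z) v))"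

section \<open>Jets and total derivatives\<close>

text \<open>The coordinates are \<open>(t, s, \<phi>)\<close>, \<open>(t, s, \<phi>, \<phi>\<^sub>t, \<phi>\<^sub>s)\<close> and
  \<open>(t, s, \<phi>, \<phi>\<^sub>t, \<phi>\<^sub>s, \<phi>\<^sub>t\<^sub>t, \<phi>\<^sub>t\<^sub>s, \<phi>\<^sub>s\<^sub>s)\<close>; in the definitions below the last five are written
  \<open>p, q, a, b, c\<close> and \<open>\<phi>\<close> is written \<open>u\<close>.\<close>

type_synonym jet0 = "real \<times> real \<times> real"
type_synonym jet1 = "real \<times> real \<times> real \<times> real \<times> real"
type_synonym jet2 = "real \<times> real \<times> real \<times> real \<times> real \<times> real \<times> real \<times> real"

fun base :: "jet1 \<Rightarrow> jet0" where
  "base (t, s, u, p, q) = (t, s, u)"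

fun first :: "jet2 \<Rightarrow> jet1" where
  "first (t, s, u, p, q, a, b, c) = (t, s, u, p, q)"

text \<open>Total derivatives, e.g. \<open>D\<^sub>t = \<partial>\<^sub>t + \<phi>\<^sub>t \<partial>\<^sub>\<phi> + \<phi>\<^sub>t\<^sub>t \<partial>\<^bsub>\<phi>t\<^esub> + \<phi>\<^sub>t\<^sub>s \<partial>\<^bsub>\<phi>s\<^esub>\<close> on functions of first
  order, written as the derivative along the vector with these components.\<close>

fun Dt0 :: "(jet0 \<Rightarrow> real) \<Rightarrow> jet1 \<Rightarrow> real" where
  "Dt0 f (t, s, u, p, q) = frechet_derivative f (at (t, s, u)) (1, 0, p)"

fun Ds0 :: "(jet0 \<Rightarrow> real) \<Rightarrow> jet1 \<Rightarrow> real" where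
  "Ds0 f (t, s, u, p, q) = frechet_derivative f (at (t, s, u)) (0, 1, q)"

fun Dt1 :: "(jet1 \<Rightarrow> real) \<Rightarrow> jet2 \<Rightarrow> real" where
  "Dt1 F (t, s, u, p, q, a, b, c) = frechet_derivative F (at (t, s, u, p, q)) (1, 0, p, a, b)"

fun Ds1 :: "(jet1 \<Rightarrow> real) \<Rightarrow> jet2 \<Rightarrow> real" where
  "Ds1 F (t, s, u, p, q, a, b, c) = frechet_derivative F (at (t, s, u, p, q)) (0, 1, q, b, c)"

text \<open>Partial derivatives with respect to \<open>\<phi>\<close>, \<open>\<phi>\<^sub>t\<close> and \<open>\<phi>\<^sub>s\<close>.\<close>

definition d_phi :: "(jet1 \<Rightarrow> real) \<Rightarrow> jet1 \<Rightarrow> real" where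
  "d_phi F j = frechet_derivative F (at j) (0, 0, 1, 0, 0)"

definition d_phit :: "(jet1 \<Rightarrow> real) \<Rightarrow> jet1 \<Rightarrow> real" where
  "d_phit F j = frechet_derivative F (at j) (0, 0, 0, 1, 0)"

definition d_phis :: "(jet1 \<Rightarrow> real) \<Rightarrow> jet1 \<Rightarrow> real" where
  "d_phis F j = frechet_derivative F (at j) (0, 0, 0, 0, 1)"

definition euler_lagrange :: "(jet1 \<Rightarrow> real) \<Rightarrow> jet2 \<Rightarrow> real" where
  "euler_lagrange L j = d_phi L (first j) - Dt1 (d_phit L) j - Ds1 (d_phis L) j"

text \<open>The real powers of \<open>\<phi>\<^sub>s\<close> require \<open>\<phi>\<^sub>s > 0\<close>.\<close>

definition jets1 :: "jet0 set \<Rightarrow> jet1 set" where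
  "jets1 D = {(t, s, u, p, q). (t, s, u) \<in> D \<and> q > 0}"

definition jets2 :: "jet0 set \<Rightarrow> jet2 set" where
  "jets2 D = {j. first j \<in> jets1 D}"

section \<open>Point vector fields and their prolongations\<close>

text \<open>The field \<open>\<xi>\<^sup>t \<partial>\<^sub>t + \<xi>\<^sup>s \<partial>\<^sub>s + \<eta> \<partial>\<^sub>\<phi>\<close> is the map \<open>(t, s, \<phi>) \<mapsto> (\<xi>\<^sup>t, \<xi>\<^sup>s, \<eta>)\<close>.\<close>

type_synonym vfield = "jet0 \<Rightarrow> real \<times> real \<times> real"

definition xi_t :: "vfield \<Rightarrow> jet0 \<Rightarrow> real" where "xi_t X z = fst (X z)"
definition xi_s :: "vfield \<Rightarrow> jet0 \<Rightarrow> real" where "xi_s X z = fst (snd (X z))"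
definition eta :: "vfield \<Rightarrow> jet0 \<Rightarrow> real" where "eta X z = snd (snd (X z))"

fun zeta_t :: "vfield \<Rightarrow> jet1 \<Rightarrow> real" where
  "zeta_t X (t, s, u, p, q) = (let j = (t, s, u, p, q) in
     Dt0 (eta X) j - p * Dt0 (xi_t X) j - q * Dt0 (xi_s X) j)"

fun zeta_s :: "vfield \<Rightarrow> jet1 \<Rightarrow> real" where
  "zeta_s X (t, s, u, p, q) = (let j = (t, s, u, p, q) in
     Ds0 (eta X) j - p * Ds0 (xi_t X) j - q * Ds0 (xi_s X) j)"

fun zeta_tt :: "vfield \<Rightarrow> jet2 \<Rightarrow> real" where
  "zeta_tt X (t, s, u, p, q, a, b, c) =
     Dt1 (zeta_t X) (t, s, u, p, q, a, b, c)
     - a * Dt0 (xi_t X) (t, s, u, p, q) - b * Dt0 (xi_s X) (t, s, u, p, q)"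

fun zeta_ts :: "vfield \<Rightarrow> jet2 \<Rightarrow> real" where
  "zeta_ts X (t, s, u, p, q, a, b, c) =
     Ds1 (zeta_t X) (t, s, u, p, q, a, b, c)
     - a * Ds0 (xi_t X) (t, s, u, p, q) - b * Ds0 (xi_s X) (t, s, u, p, q)"

fun zeta_ss :: "vfield \<Rightarrow> jet2 \<Rightarrow> real" where
  "zeta_ss X (t, s, u, p, q, a, b, c) =
     Ds1 (zeta_s X) (t, s, u, p, q, a, b, c)
     - b * Ds0 (xi_t X) (t, s, u, p, q) - c * Ds0 (xi_s X) (t, s, u, p, q)"

definition prolong1 :: "vfield \<Rightarrow> (jet1 \<Rightarrow> real) \<Rightarrow> jet1 \<Rightarrow> real" where
  "prolong1 X F j = frechet_derivative F (at j)
     (xi_t X (base j), xi_s X (base j), eta X (base j), zeta_t X j, zeta_s X j)"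

definition prolong2 :: "vfield \<Rightarrow> (jet2 \<Rightarrow> real) \<Rightarrow> jet2 \<Rightarrow> real" where
  "prolong2 X F j = frechet_derivative F (at j)
     (xi_t X (base (first j)), xi_s X (base (first j)), eta X (base (first j)),
      zeta_t X (first j), zeta_s X (first j), zeta_tt X j, zeta_ts X j, zeta_ss X j)"

section \<open>Symmetries and conservation laws\<close>

text \<open>Infinitesimal invariance of the second-order equation \<open>F = 0\<close>.\<close>

definition point_symmetry :: "jet0 set \<Rightarrow> (jet2 \<Rightarrow> real) \<Rightarrow> vfield \<Rightarrow> bool" where
  "point_symmetry D F X \<longleftrightarrow>
     Ck_on 2 D X \<and> (\<forall>j\<in>jets2 D. F j = 0 \<longrightarrow> prolong2 X F j = 0)"

definition noether_with ::
  "jet0 set \<Rightarrow> (jet1 \<Rightarrow> real) \<Rightarrow> vfield \<Rightarrow> (jet0 \<Rightarrow> real) \<Rightarrow> (jet0 \<Rightarrow> real) \<Rightarrow> bool" where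
  "noether_with D L X B1 B2 \<longleftrightarrow> Ck_on 2 D X \<and> Ck_on 1 D B1 \<and> Ck_on 1 D B2 \<and>
     (\<forall>j\<in>jets1 D. prolong1 X L j + L j * (Dt0 (xi_t X) j + Ds0 (xi_s X) j) = Dt0 B1 j + Ds0 B2 j)"

definition noether_symmetry :: "jet0 set \<Rightarrow> (jet1 \<Rightarrow> real) \<Rightarrow> vfield \<Rightarrow> bool" where
  "noether_symmetry D L X \<longleftrightarrow> (\<exists>B1 B2. noether_with D L X B1 B2)"

definition variational_symmetry :: "jet0 set \<Rightarrow> (jet1 \<Rightarrow> real) \<Rightarrow> vfield \<Rightarrow> bool" where
  "variational_symmetry D L X \<longleftrightarrow> noether_with D L X (\<lambda>_. 0) (\<lambda>_. 0)"

definition divergent_symmetry :: "jet0 set \<Rightarrow> (jet1 \<Rightarrow> real) \<Rightarrow> vfield \<Rightarrow> bool" where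
  "divergent_symmetry D L X \<longleftrightarrow> noether_symmetry D L X \<and> \<not> variational_symmetry D L X"

definition conservation_law ::
  "jet0 set \<Rightarrow> (jet2 \<Rightarrow> real) \<Rightarrow> (jet1 \<Rightarrow> real) \<Rightarrow> (jet1 \<Rightarrow> real) \<Rightarrow> bool" where
  "conservation_law D F Tt Ts \<longleftrightarrow>
     (\<forall>j\<in>jets1 D. Tt differentiable (at j) \<and> Ts differentiable (at j)) \<and>
     (\<forall>j\<in>jets2 D. F j = 0 \<longrightarrow> Dt1 Tt j + Ds1 Ts j = 0)"

text \<open>The densities given by Noether's theorem.\<close>

fun noether_t :: "(jet1 \<Rightarrow> real) \<Rightarrow> vfield \<Rightarrow> (jet0 \<Rightarrow> real) \<Rightarrow> jet1 \<Rightarrow> real" where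
  "noether_t L X B1 (t, s, u, p, q) = (let z = (t, s, u); j = (t, s, u, p, q) in
     xi_t X z * L j + (eta X z - xi_t X z * p - xi_s X z * q) * d_phit L j - B1 z)"

fun noether_s :: "(jet1 \<Rightarrow> real) \<Rightarrow> vfield \<Rightarrow> (jet0 \<Rightarrow> real) \<Rightarrow> jet1 \<Rightarrow> real" where
  "noether_s L X B2 (t, s, u, p, q) = (let z = (t, s, u); j = (t, s, u, p, q) in
     xi_s X z * L j + (eta X z - xi_t X z * p - xi_s X z * q) * d_phis L j - B2 z)"

text \<open>A conserved vector is customarily given only up to a nonzero constant factor (for the energy
  this factor is \<open>-1\<close>).\<close>

definition provides_law ::
  "jet0 set \<Rightarrow> (jet1 \<Rightarrow> real) \<Rightarrow> (jet2 \<Rightarrow> real) \<Rightarrow> vfield \<Rightarrow> (jet0 \<Rightarrow> real) \<Rightarrow> (jet0 \<Rightarrow> real) \<Rightarrow>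
   (jet1 \<Rightarrow> real) \<Rightarrow> (jet1 \<Rightarrow> real) \<Rightarrow> bool" where
  "provides_law D L F X B1 B2 Tt Ts \<longleftrightarrow>
     noether_with D L X B1 B2 \<and> conservation_law D F Tt Ts \<and>
     (\<exists>k. k \<noteq> 0 \<and> (\<forall>j\<in>jets1 D. Tt j = k * noether_t L X B1 j \<and> Ts j = k * noether_s L X B2 j))"

definition lin_comb :: "(nat \<Rightarrow> real) \<Rightarrow> vfield list \<Rightarrow> vfield" where
  "lin_comb c Xs z = (\<Sum>i<length Xs. c i *\<^sub>R (Xs ! i) z)"

text \<open>On \<open>D\<close>, the fields with property \<open>V\<close> form a vector space with basis \<open>Xs\<close>.\<close>

definition basis_on :: "jet0 set \<Rightarrow> vfield list \<Rightarrow> (vfield \<Rightarrow> bool) \<Rightarrow> bool" where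
  "basis_on D Xs V \<longleftrightarrow>
     (\<forall>X. V X \<longleftrightarrow> (\<exists>c. \<forall>z\<in>D. X z = lin_comb c Xs z)) \<and>
     (\<forall>c. (\<forall>z\<in>D. lin_comb c Xs z = 0) \<longrightarrow> (\<forall>i<length Xs. c i = 0))"

section \<open>The gas dynamics equation\<close>

text \<open>\<open>phipow n \<gamma> \<phi>\<close> is \<open>\<phi>\<^bsup>n(1-\<gamma>)\<^esup>\<close>.  The outer exponent is a natural number, so that for \<open>n = 0\<close>
  the value is 1 for every real \<open>\<phi>\<close> (whereas \<open>0 powr 0 = 0\<close>).\<close>

definition phipow :: "nat \<Rightarrow> real \<Rightarrow> real \<Rightarrow> real" where
  "phipow n \<gamma> u = (u powr (1 - \<gamma>)) ^ n"

fun lagrangian :: "nat \<Rightarrow> real \<Rightarrow> (real \<Rightarrow> real) \<Rightarrow> jet1 \<Rightarrow> real" where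
  "lagrangian n \<gamma> S (t, s, u, p, q) =
     p\<^sup>2 / 2 - S s / (\<gamma> - 1) * phipow n \<gamma> u * q powr (1 - \<gamma>)"

fun gas :: "nat \<Rightarrow> real \<Rightarrow> (real \<Rightarrow> real) \<Rightarrow> jet2 \<Rightarrow> real" where
  "gas n \<gamma> S (t, s, u, p, q, a, b, c) =
     a + phipow n \<gamma> u * q powr (- \<gamma>) *
       (deriv S s - real n * \<gamma> * S s * (q / u) - \<gamma> * S s * (c / q))"

definition gamma_star :: "nat \<Rightarrow> real" where
  "gamma_star n = (real n + 3) / (real n + 1)"

definition arbitrary_S_symmetry :: "jet0 set \<Rightarrow> nat \<Rightarrow> real \<Rightarrow> vfield \<Rightarrow> bool" where
  "arbitrary_S_symmetry D n \<gamma> X \<longleftrightarrow> (\<forall>S. Ck_on 2 UNIV S \<longrightarrow> point_symmetry D (gas n \<gamma> S) X)"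

fun X_time :: vfield where
  "X_time (t, s, u) = (1, 0, 0)"

fun X_scale :: "nat \<Rightarrow> real \<Rightarrow> vfield" where
  "X_scale n \<gamma> (t, s, u) = (((real n + 1) * \<gamma> - real n + 1) * t, 0, 2 * u)"

fun X_shift :: vfield where
  "X_shift (t, s, u) = (0, 0, 1)"

fun X_galilei :: vfield where
  "X_galilei (t, s, u) = (0, 0, t)"

fun X_proj :: vfield where
  "X_proj (t, s, u) = (t\<^sup>2, 0, t * u)"

definition X_half :: "nat \<Rightarrow> real \<Rightarrow> vfield" where
  "X_half n \<gamma> z = (1 / 2) *\<^sub>R X_scale n \<gamma> z"

definition symmetries :: "nat \<Rightarrow> real \<Rightarrow> vfield list" where
  "symmetries n \<gamma> = [X_time, X_scale n \<gamma>]
     @ (if n = 0 then [X_shift, X_galilei] else [])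
     @ (if \<gamma> = gamma_star n then [X_proj] else [])"

fun energy_t :: "nat \<Rightarrow> real \<Rightarrow> (real \<Rightarrow> real) \<Rightarrow> jet1 \<Rightarrow> real" where
  "energy_t n \<gamma> S (t, s, u, p, q) =
     p\<^sup>2 / 2 + S s / (\<gamma> - 1) * phipow n \<gamma> u * q powr (1 - \<gamma>)"

fun energy_s :: "nat \<Rightarrow> real \<Rightarrow> (real \<Rightarrow> real) \<Rightarrow> jet1 \<Rightarrow> real" where
  "energy_s n \<gamma> S (t, s, u, p, q) = p * S s * phipow n \<gamma> u * q powr (- \<gamma>)"

fun momentum_t :: "jet1 \<Rightarrow> real" where
  "momentum_t (t, s, u, p, q) = p"

fun momentum_s :: "real \<Rightarrow> (real \<Rightarrow> real) \<Rightarrow> jet1 \<Rightarrow> real" where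
  "momentum_s \<gamma> S (t, s, u, p, q) = S s * q powr (- \<gamma>)"

fun center_t :: "jet1 \<Rightarrow> real" where
  "center_t (t, s, u, p, q) = u - t * p"

fun center_s :: "real \<Rightarrow> (real \<Rightarrow> real) \<Rightarrow> jet1 \<Rightarrow> real" where
  "center_s \<gamma> S (t, s, u, p, q) = - t * S s * q powr (- \<gamma>)"

text \<open>\<open>\<phi>\<^bsup>-n\<gamma>+n+1\<^esup>\<close> is written \<open>phipow n \<gamma> \<phi> * \<phi>\<close>.\<close>

fun scaling_t :: "nat \<Rightarrow> real \<Rightarrow> (real \<Rightarrow> real) \<Rightarrow> jet1 \<Rightarrow> real" where
  "scaling_t n \<gamma> S (t, s, u, p, q) =
     2 * t * (- (p\<^sup>2 / 2) - S s / (\<gamma> - 1) * phipow n \<gamma> u * q powr (1 - \<gamma>)) + u * p"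

fun scaling_s :: "nat \<Rightarrow> real \<Rightarrow> (real \<Rightarrow> real) \<Rightarrow> jet1 \<Rightarrow> real" where
  "scaling_s n \<gamma> S (t, s, u, p, q) =
     - 2 * t * S s * phipow n \<gamma> u * p * q powr (- \<gamma>)
     + S s * (phipow n \<gamma> u * u) * q powr (- \<gamma>)"

fun proj_t :: "nat \<Rightarrow> real \<Rightarrow> (real \<Rightarrow> real) \<Rightarrow> jet1 \<Rightarrow> real" where
  "proj_t n \<gamma> S (t, s, u, p, q) =
     - t\<^sup>2 * (p\<^sup>2 / 2 + S s / (\<gamma> - 1) * phipow n \<gamma> u * q powr (1 - \<gamma>)) + t * u * p - u\<^sup>2 / 2"

fun proj_s :: "nat \<Rightarrow> real \<Rightarrow> (real \<Rightarrow> real) \<Rightarrow> jet1 \<Rightarrow> real" where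
  "proj_s n \<gamma> S (t, s, u, p, q) =
     - t\<^sup>2 * S s * phipow n \<gamma> u * p * q powr (- \<gamma>)
     + t * S s * (phipow n \<gamma> u * u) * q powr (- \<gamma>)"

end

theory Submission
  imports Defs
begin

text \<open>
  At a given point the values \<open>S\<close>, \<open>S'\<close>, \<open>S''\<close> of an arbitrary \<open>S\<close> are independent, so invariance of the
  equation splits: \<open>S = S' = S'' = 0\<close> gives the conditions for \<open>\<phi>\<^sub>t\<^sub>t = 0\<close>, the coefficient of \<open>S''\<close> gives
  \<open>\<xi>\<^sup>s = 0\<close>, and the coefficients of \<open>S'\<close> and \<open>S\<close> show that \<open>\<xi>\<^sup>t\<close> depends on \<open>t\<close> alone,
  \<open>\<eta>\<close> is affine in \<open>\<phi>\<close> (linear if \<open>n \<noteq> 0\<close>) and \<open>k \<eta>\<^sub>\<phi> = 2 \<xi>\<^sup>t\<^sub>t\<close> with \<open>k = (n + 1) \<gamma> - n + 1\<close>.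
  Together with \<open>2 \<eta>\<^sub>t\<^sub>\<phi> = \<xi>\<^sup>t\<^sub>t\<^sub>t\<close> this forces \<open>(k - 4) \<eta>\<^sub>t\<^sub>\<phi> = 0\<close>, and \<open>k = 4\<close> means \<open>\<gamma> = \<gamma>\<^sub>*\<close>.
  On the resulting fields the Noether expression is \<open>(4 - k) c\<^sub>1 L + c\<^sub>3 \<phi>\<^sub>t + c\<^sub>4 \<phi> \<phi>\<^sub>t\<close>, which is a
  divergence of functions of \<open>(t, s, \<phi>)\<close> only if \<open>(4 - k) c\<^sub>1 = 0\<close>.
\<close>

section \<open>Directional derivatives of \<open>C\<^sup>k\<close> functions\<close>

text \<open>Two obstacles shape the proof. Fields are only \<open>Ck_on 2\<close>, so the
  second-order determining equations cannot be differentiated again; and \<open>D\<close> is only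
  open and connected, so moving along coordinate lines is possible only locally. Therefore the mixed
  derivative \<open>dt (du (eta X))\<close> is shown to be locally constant by translation arguments
  and then constant by connectedness. After that \<open>du (eta X)\<close>,
  \<open>dt (eta X)\<close>, \<open>xi_t X\<close> and \<open>eta X\<close> each have the gradient
  of an explicit polynomial and differ from it by a constant. The mixed derivative and these four
  constants are, up to a factor, the five coefficients of \<open>sym_field\<close>. Every class of
  fields in the basis claims becomes a set of linear conditions on the coefficients, so these claims
  reduce to matching coefficients. The number 4 arises by differentiating the relation between
  \<open>du (eta X)\<close> and \<open>dt (xi_t X)\<close> in t: the left side is k times the mixed
  derivative, the right side 4 times it.\<close>

lemma Ck_on_cong:
  assumes "open D" "Ck_on k D f" "\<And>z. z \<in> D \<Longrightarrow> f z = g z"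
  shows "Ck_on k D g"
  using assms(2,3)
proof (induction k arbitrary: f g)
  case 0
  then show ?case by (simp cong: continuous_on_cong)
next
  case (Suc k)
  have eq: "frechet_derivative g (at z) = frechet_derivative f (at z)" if "z \<in> D" for z
    using frechet_derivative_transform_within_open[of f z D g] Suc.prems assms(1) that by auto
  have "g differentiable (at z)" if "z \<in> D" for z
    using Suc.prems that assms(1)
    by (meson Ck_on.simps(2) differentiable_def has_derivative_transform_within_open)
  moreover have "Ck_on k D (\<lambda>z. frechet_derivative g (at z) v)" for v
    by (rule Suc.IH[of "\<lambda>z. frechet_derivative f (at z) v"]) (use Suc.prems eq in auto)
  ultimately show ?case by simp
qed

text \<open>\<open>Ck_on\<close> speaks about \<open>frechet_derivative\<close>; with this rule
  regularity is checked on an explicitly given derivative.\<close>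

lemma Ck_on_SucI:
  assumes "open D" "\<And>z. z \<in> D \<Longrightarrow> (f has_derivative f' z) (at z)"
    and "\<And>v. Ck_on k D (\<lambda>z. f' z v)"
  shows "Ck_on (Suc k) D f"
proof -
  have eq: "frechet_derivative f (at z) = f' z" if "z \<in> D" for z
    using frechet_derivative_at[OF assms(2)[OF that]] by simp
  have "Ck_on k D (\<lambda>z. frechet_derivative f (at z) v)" for v
    by (rule Ck_on_cong[OF assms(1) assms(3)[of v]]) (simp add: eq)
  then show ?thesis using assms(2) by (auto simp: differentiable_def)
qed

lemma Ck_on_bounded_linear:
  assumes "open D" "bounded_linear h" "Ck_on k D f"
  shows "Ck_on k D (\<lambda>z. h (f z))"
  using assms(3)
proof (induction k arbitrary: f)
  case 0
  then show ?case using bounded_linear.continuous_on[OF assms(2)] by simp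
next
  case (Suc k)
  show ?case
  proof (rule Ck_on_SucI[OF assms(1)])
    show "((\<lambda>z. h (f z)) has_derivative (\<lambda>v. h (frechet_derivative f (at z) v))) (at z)"
      if "z \<in> D" for z
      using Suc.prems that by (intro bounded_linear.has_derivative[OF assms(2)])
        (simp add: frechet_derivative_works[symmetric])
    show "Ck_on k D (\<lambda>z. h (frechet_derivative f (at z) v))" for v
      using Suc by simp
  qed
qed

text \<open>The direction precedes the point, so that \<open>dird f v\<close> is again a function on
  the space and second derivatives are nested applications.\<close>

definition dird :: "('a::real_normed_vector \<Rightarrow> 'b::real_normed_vector) \<Rightarrow> 'a \<Rightarrow> 'a \<Rightarrow> 'b" where
  "dird f v z = frechet_derivative f (at z) v"

lemma dird_eqI: "(f has_derivative f') (at z) \<Longrightarrow> dird f v z = f' v"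
  unfolding dird_def by (metis frechet_derivative_at)

lemma dird_works: "f differentiable (at z) \<Longrightarrow> (f has_derivative (\<lambda>v. dird f v z)) (at z)"
  unfolding dird_def by (simp add: frechet_derivative_works[symmetric])

lemma dird_cong:
  assumes "open D" "z \<in> D" "f differentiable (at z)" "\<And>z. z \<in> D \<Longrightarrow> f z = g z"
  shows "dird f v z = dird g v z"
  unfolding dird_def using frechet_derivative_transform_within_open[of f z D g] assms by simp

lemma Ck_on_SucD:
  assumes "Ck_on (Suc k) D f"
  shows "z \<in> D \<Longrightarrow> f differentiable (at z)" "Ck_on k D (dird f v)"
  using assms by (auto simp: dird_def[abs_def])

lemma Ck_on_2D:
  assumes "Ck_on 2 D f"
  shows "z \<in> D \<Longrightarrow> f differentiable (at z)" "z \<in> D \<Longrightarrow> dird f v differentiable (at z)"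
  using assms by (auto simp: numeral_2_eq_2 dird_def[abs_def])

lemma dird_line:
  assumes "f differentiable (at (z + x *\<^sub>R v))"
  shows "((\<lambda>x. f (z + x *\<^sub>R v)) has_derivative (\<lambda>h. h *\<^sub>R dird f v (z + x *\<^sub>R v))) (at x)"
proof -
  have *: "((\<lambda>x. z + x *\<^sub>R v) has_derivative (\<lambda>h. h *\<^sub>R v)) (at x)"
    by (auto intro!: derivative_eq_intros)
  have lin: "linear (\<lambda>w. dird f w (z + x *\<^sub>R v))"
    using has_derivative_linear[OF dird_works[OF assms]] .
  show ?thesis
    using has_derivative_compose[OF * dird_works[OF assms]] linear_scale[OF lin] by simp
qed

text \<open>The classical route to the symmetry of second derivatives: the mean value theorem in
  direction v turns the second difference into a difference of values of \<open>dird f v\<close>,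
  and the linear approximation of \<open>dird f v\<close> at the single point z evaluates it up to
  o(h).\<close>

lemma second_difference_tendsto:
  fixes f :: "'a::real_normed_vector \<Rightarrow> real"
  assumes "open D" "z \<in> D" and f: "\<And>z. z \<in> D \<Longrightarrow> f differentiable (at z)"
    and fv: "dird f v differentiable (at z)"
  shows "((\<lambda>h. (f (z + h *\<^sub>R v + h *\<^sub>R w) - f (z + h *\<^sub>R v) - f (z + h *\<^sub>R w) + f z) / h\<^sup>2)
    \<longlongrightarrow> dird (dird f v) w z) (at_right 0)"
proof (rule tendstoI)
  fix e :: real assume "e > 0"
  define g where "g = dird f v"
  define g' where "g' k = dird g k z" for k
  have lin: "linear g'"
    using has_derivative_linear[OF dird_works[OF fv]] by (simp add: g'_def[abs_def] g_def)
  \<comment> \<open>Measured in units of h, the two evaluation points \<open>y1\<close> and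
    \<open>y2\<close> lie within norm v + norm w and norm v of z. \<open>M\<close> bounds the sum of
    these distances, and \<open>d\<close> is chosen so that the total error is at most e/2 times
    h.\<close>
  define M where "M = 2 * norm v + norm w + 1"
  have M: "M > 0" by (simp add: M_def add_nonneg_pos)
  define d where "d = e / (2 * M)"
  have d: "d > 0" using \<open>e > 0\<close> M by (simp add: d_def)
  obtain r where r: "r > 0" and gr: "\<And>y. norm (y - z) < r \<Longrightarrow> \<bar>g y - g z - g' (y - z)\<bar> \<le> d * norm (y - z)"
    using dird_works[OF fv] d unfolding has_derivative_at_alt g'_def g_def real_norm_def by blast
  obtain r2 where r2: "r2 > 0" "ball z r2 \<subseteq> D" using assms(1,2) by (meson openE)
  define r3 where "r3 = min r r2 / M"
  have r3: "r3 > 0" using r r2 M by (simp add: r3_def)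
  have main: "\<bar>(f (z + h *\<^sub>R v + h *\<^sub>R w) - f (z + h *\<^sub>R v) - f (z + h *\<^sub>R w) + f z) / h\<^sup>2 - g' w\<bar> < e"
    if h: "0 < h" "h < r3" for h
  proof -
    have hM: "h * M < min r r2" using h M by (simp add: r3_def pos_less_divide_eq)
    have small: "norm (x *\<^sub>R v + y *\<^sub>R w) \<le> h * (norm v + norm w)"
      if "0 \<le> x" "x \<le> h" "0 \<le> y" "y \<le> h" for x y
    proof -
      have "norm (x *\<^sub>R v + y *\<^sub>R w) \<le> x * norm v + y * norm w"
        using norm_triangle_ineq[of "x *\<^sub>R v" "y *\<^sub>R w"] that by simp
      also have "\<dots> \<le> h * norm v + h * norm w"
        using that by (intro add_mono mult_right_mono) auto
      finally show ?thesis by (simp add: algebra_simps)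
    qed
    have lt: "h * (norm v + norm w) < min r r2"
    proof -
      have "norm v + norm w \<le> M" by (simp add: M_def)
      then have "h * (norm v + norm w) \<le> h * M" using h(1) by (intro mult_left_mono) auto
      then show ?thesis using hM by linarith
    qed
    have inD: "z + y *\<^sub>R w + x *\<^sub>R v \<in> D" if "0 \<le> x" "x \<le> h" "0 \<le> y" "y \<le> h" for x y
    proof -
      have "dist z (z + y *\<^sub>R w + x *\<^sub>R v) = norm (x *\<^sub>R v + y *\<^sub>R w)"
        by (simp add: dist_norm norm_minus_commute algebra_simps)
      then show ?thesis using small[OF that] lt r2 by auto
    qed
    \<comment> \<open>The second difference is \<open>\<phi> h - \<phi> 0\<close>. The zero multiple
      of w gives both points the common shape that \<open>inD\<close> covers.\<close>
    define \<phi> where "\<phi> x = f (z + h *\<^sub>R w + x *\<^sub>R v) - f (z + 0 *\<^sub>R w + x *\<^sub>R v)" for x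
    have "\<exists>x. 0 < x \<and> x < h \<and> \<phi> h - \<phi> 0 = (h - 0) * (g (z + h *\<^sub>R w + x *\<^sub>R v) - g (z + 0 *\<^sub>R w + x *\<^sub>R v))"
    proof (rule MVT2)
      show "0 < h" by fact
      fix x assume x: "0 \<le> x" "x \<le> h"
      have "(\<phi> has_derivative (\<lambda>k. k *\<^sub>R g (z + h *\<^sub>R w + x *\<^sub>R v) - k *\<^sub>R g (z + 0 *\<^sub>R w + x *\<^sub>R v))) (at x)"
        unfolding \<phi>_def[abs_def] g_def
        by (intro has_derivative_diff dird_line f inD) (use x h in auto)
      then show "(\<phi> has_real_derivative (g (z + h *\<^sub>R w + x *\<^sub>R v) - g (z + 0 *\<^sub>R w + x *\<^sub>R v))) (at x)"
        unfolding has_field_derivative_def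
        by (rule has_derivative_eq_rhs) (auto simp: algebra_simps)
    qed
    then obtain x where x: "0 < x" "x < h"
      and eq: "\<phi> h - \<phi> 0 = h * (g (z + h *\<^sub>R w + x *\<^sub>R v) - g (z + 0 *\<^sub>R w + x *\<^sub>R v))"
      by auto
    define y1 y2 where "y1 = z + h *\<^sub>R w + x *\<^sub>R v" and "y2 = z + 0 *\<^sub>R w + x *\<^sub>R v"
    have y1: "y1 - z = x *\<^sub>R v + h *\<^sub>R w" and y2: "y2 - z = x *\<^sub>R v" by (auto simp: y1_def y2_def)
    have n1: "norm (y1 - z) \<le> h * (norm v + norm w)" using small[of x h] x y1 by simp
    have n2: "norm (y2 - z) \<le> h * norm v" using x y2 by (simp add: mult_right_mono)
    have n2': "norm (y2 - z) < r" using n2 lt h(1) by (simp add: distrib_left) (smt (verit) mult_nonneg_nonneg norm_ge_zero)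
    have a1: "\<bar>g y1 - g z - g' (y1 - z)\<bar> \<le> d * (h * (norm v + norm w))"
      using gr[of y1] n1 lt d by (smt (verit) mult_left_mono)
    have a2: "\<bar>g y2 - g z - g' (y2 - z)\<bar> \<le> d * (h * norm v)"
      using gr[of y2] n2 n2' d by (smt (verit) mult_left_mono)
    have g'12: "g' (y1 - z) - g' (y2 - z) = h * g' w"
      unfolding y1 y2 using linear_add[OF lin] linear_scale[OF lin] by simp
    have "\<bar>(g y1 - g y2) - h * g' w\<bar> \<le> d * (h * (norm v + norm w)) + d * (h * norm v)"
      using a1 a2 g'12 by linarith
    also have "\<dots> \<le> d * h * M" using d h by (simp add: M_def algebra_simps)
    also have "\<dots> = e / 2 * h" using M by (simp add: d_def)
    also have "\<dots> < e * h" using h \<open>e > 0\<close> by simp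
    finally have fin: "\<bar>(g y1 - g y2) - h * g' w\<bar> < e * h" .
    have E: "f (z + h *\<^sub>R v + h *\<^sub>R w) - f (z + h *\<^sub>R v) - f (z + h *\<^sub>R w) + f z = h * (g y1 - g y2)"
      using eq by (simp add: \<phi>_def y1_def y2_def add_ac)
    have "(f (z + h *\<^sub>R v + h *\<^sub>R w) - f (z + h *\<^sub>R v) - f (z + h *\<^sub>R w) + f z) / h\<^sup>2 - g' w
      = ((g y1 - g y2) - h * g' w) / h"
      unfolding E using h by (simp add: diff_divide_distrib power2_eq_square)
    then show ?thesis using fin h by (simp add: pos_divide_less_eq)
  qed
  show "\<forall>\<^sub>F h in at_right 0. dist ((f (z + h *\<^sub>R v + h *\<^sub>R w) - f (z + h *\<^sub>R v) - f (z + h *\<^sub>R w) + f z) / h\<^sup>2)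
     (dird (dird f v) w z) < e"
    unfolding eventually_at_right_field dist_real_def
    using main r3 by (auto simp: g'_def g_def intro!: exI[of _ r3])
qed

text \<open>The second difference is symmetric in v and w, and both iterated derivatives are its
  limit.\<close>

lemma dird_commute:
  fixes f :: "'a::real_normed_vector \<Rightarrow> real"
  assumes "open D" "Ck_on 2 D f" "z \<in> D"
  shows "dird (dird f v) w z = dird (dird f w) v z"
proof (rule tendsto_unique)
  note * = second_difference_tendsto[OF assms(1,3) Ck_on_2D(1)[OF assms(2)]
      Ck_on_2D(2)[OF assms(2,3)]]
  show "((\<lambda>h. (f (z + h *\<^sub>R v + h *\<^sub>R w) - f (z + h *\<^sub>R v) - f (z + h *\<^sub>R w) + f z) / h\<^sup>2)
    \<longlongrightarrow> dird (dird f v) w z) (at_right 0)" by (rule *)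
  show "((\<lambda>h. (f (z + h *\<^sub>R v + h *\<^sub>R w) - f (z + h *\<^sub>R v) - f (z + h *\<^sub>R w) + f z) / h\<^sup>2)
    \<longlongrightarrow> dird (dird f w) v z) (at_right 0)"
    using *[of w v] by (simp add: add_ac)
      (simp add: algebra_simps)
qed simp

lemma eq_along_direction:
  fixes f :: "'a::real_normed_vector \<Rightarrow> real"
  assumes "convex B" "\<And>z. z \<in> B \<Longrightarrow> f differentiable (at z)"
    and "\<And>z. z \<in> B \<Longrightarrow> dird f v z = 0" and "z \<in> B" "z + h *\<^sub>R v \<in> B"
  shows "f (z + h *\<^sub>R v) = f z"
proof -
  have inB: "z + x *\<^sub>R (h *\<^sub>R v) \<in> B" if "0 \<le> x" "x \<le> 1" for x
    using convexD_alt[OF assms(1,4,5) that] by (simp add: algebra_simps)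
  have "((\<lambda>x. f (z + x *\<^sub>R (h *\<^sub>R v))) has_real_derivative 0) (at x)" if "0 \<le> x" "x \<le> 1" for x
  proof -
    have "dird f (h *\<^sub>R v) (z + x *\<^sub>R (h *\<^sub>R v)) = h *\<^sub>R dird f v (z + x *\<^sub>R (h *\<^sub>R v))"
      using linear_scale[OF has_derivative_linear[OF dird_works]] assms(2) inB that by blast
    then show ?thesis
      using dird_line[OF assms(2)[OF inB[OF that]]] assms(3)[OF inB[OF that]]
      by (simp add: has_field_derivative_def lambda_zero)
  qed
  from MVT2[of 0 1 "\<lambda>x. f (z + x *\<^sub>R (h *\<^sub>R v))" "\<lambda>_. 0"] this
  show ?thesis by auto
qed

text \<open>Near z the function coincides with its translate by \<open>h *\<^sub>R v\<close>, so all
  its directional derivatives agree at the two points. Applied to a first derivative of a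
  \<open>Ck_on 2\<close> function, this moves second derivatives along v although third derivatives
  may not exist.\<close>

lemma dird_eq_along_direction:
  fixes f :: "'a::real_normed_vector \<Rightarrow> real"
  assumes "convex B" "open B" "\<And>z. z \<in> B \<Longrightarrow> f differentiable (at z)"
    and "\<And>z. z \<in> B \<Longrightarrow> dird f v z = 0" and "z \<in> B" "z + h *\<^sub>R v \<in> B"
  shows "dird f w (z + h *\<^sub>R v) = dird f w z"
proof -
  define U where "U = B \<inter> (\<lambda>y. y + h *\<^sub>R v) -` B"
  have U: "open U" "z \<in> U"
    using assms by (auto simp: U_def intro!: open_Int open_vimage continuous_intros)
  have shift: "((\<lambda>y. y + h *\<^sub>R v) has_derivative (\<lambda>k. k)) (at z)"
    by (auto intro!: derivative_eq_intros)
  have "((\<lambda>y. f (y + h *\<^sub>R v)) has_derivative (\<lambda>k. dird f k (z + h *\<^sub>R v))) (at z)"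
    using has_derivative_compose[OF shift dird_works[OF assms(3)[OF assms(6)]]] by simp
  then have "(f has_derivative (\<lambda>k. dird f k (z + h *\<^sub>R v))) (at z)"
    by (rule has_derivative_transform_within_open[OF _ U])
      (use eq_along_direction[OF assms(1,3,4)] in \<open>auto simp: U_def\<close>)
  then show ?thesis using dird_eqI by metis
qed

section \<open>Prolongations in coordinates\<close>

abbreviation dt :: "(jet0 \<Rightarrow> real) \<Rightarrow> jet0 \<Rightarrow> real" where "dt f \<equiv> dird f (1, 0, 0)"
abbreviation ds :: "(jet0 \<Rightarrow> real) \<Rightarrow> jet0 \<Rightarrow> real" where "ds f \<equiv> dird f (0, 1, 0)"
abbreviation du :: "(jet0 \<Rightarrow> real) \<Rightarrow> jet0 \<Rightarrow> real" where "du f \<equiv> dird f (0, 0, 1)"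

lemma dird_coords:
  assumes "f differentiable (at z)"
  shows "dird f (x, y, w) z = x * dt f z + y * ds f z + w * du f z"
proof -
  have lin: "linear (\<lambda>v. dird f v z)" using has_derivative_linear[OF dird_works[OF assms]] .
  have "(x, y, w) = x *\<^sub>R (1, 0, 0) + y *\<^sub>R (0, 1, 0) + w *\<^sub>R (0, 0, 1::real)" by simp
  then have "dird f (x, y, w) z = dird f (x *\<^sub>R (1, 0, 0) + y *\<^sub>R (0, 1, 0) + w *\<^sub>R (0, 0, 1)) z"
    by simp
  also have "\<dots> = x * dt f z + y * ds f z + w * du f z"
    using linear_add[OF lin] linear_scale[OF lin] by (simp del: scaleR_Pair add_Pair)
  finally show ?thesis .
qed

lemma Dt0_eq:
  "f differentiable (at (t, s, u)) \<Longrightarrow> Dt0 f (t, s, u, p, q) = dt f (t, s, u) + p * du f (t, s, u)"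
  using dird_coords[of f "(t, s, u)" 1 0 p] by (simp add: dird_def)

lemma Ds0_eq:
  "f differentiable (at (t, s, u)) \<Longrightarrow> Ds0 f (t, s, u, p, q) = ds f (t, s, u) + q * du f (t, s, u)"
  using dird_coords[of f "(t, s, u)" 0 1 q] by (simp add: dird_def)

lemma base_eq: "base = (\<lambda>j. (fst j, fst (snd j), fst (snd (snd j))))"
  by (auto simp: fun_eq_iff)

lemma mem_jets1: "(t, s, u, p, q) \<in> jets1 D \<longleftrightarrow> (t, s, u) \<in> D \<and> q > 0"
  by (simp add: jets1_def)

lemma mem_jets2: "(t, s, u, p, q, a, b, c) \<in> jets2 D \<longleftrightarrow> (t, s, u) \<in> D \<and> q > 0"
  by (simp add: jets2_def jets1_def)

lemma open_jets1:
  assumes "open D"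
  shows "open (jets1 D)"
proof -
  have "jets1 D = base -` D \<inter> {j. snd (snd (snd (snd j))) > 0}"
    by (auto simp: jets1_def)
  moreover have "open \<dots>"
    using assms by (intro open_Int open_vimage open_Collect_less)
      (auto simp: base_eq intro!: continuous_intros)
  ultimately show ?thesis by simp
qed

lemma bounded_linear_base: "bounded_linear base"
  unfolding base_eq
  by (intro bounded_linear_Pair bounded_linear_compose[OF bounded_linear_fst]
      bounded_linear_compose[OF bounded_linear_snd] bounded_linear_fst bounded_linear_snd)

lemma has_derivative_base:
  "f differentiable (at (base j)) \<Longrightarrow>
   ((\<lambda>j. f (base j)) has_derivative (\<lambda>h. dird f (base h) (base j))) (at j)"
  using has_derivative_compose[OF bounded_linear_imp_has_derivative[OF bounded_linear_base] dird_works]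
  by blast

text \<open>This is the product rule for \<open>dt f + p * du f\<close>. \<open>Dt0 f\<close> is
  identified with that expression only over \<open>D\<close>, hence the transfer on the open set
  \<open>jets1 D\<close>.\<close>

lemma Dt0_has_derivative:
  assumes "open D" "Ck_on 2 D f" "(t, s, u) \<in> D" "q > 0"
  shows "(Dt0 f has_derivative (\<lambda>h. dird (dt f) (base h) (t, s, u)
      + (fst (snd (snd (snd h))) * du f (t, s, u) + p * dird (du f) (base h) (t, s, u))))
    (at (t, s, u, p, q))"
proof -
  have hb: "((\<lambda>j. dird f v (base j)) has_derivative (\<lambda>h. dird (dird f v) (base h) (t, s, u)))
      (at (t, s, u, p, q))" for v
    using has_derivative_base[of "dird f v" "(t, s, u, p, q)"] Ck_on_2D(2)[OF assms(2,3)] by simp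
  show ?thesis
  proof (rule has_derivative_transform_within_open[OF _ open_jets1[OF assms(1)]])
  show "((\<lambda>j. dt f (base j) + fst (snd (snd (snd j))) * du f (base j)) has_derivative
    (\<lambda>h. dird (dt f) (base h) (t, s, u)
      + (fst (snd (snd (snd h))) * du f (t, s, u) + p * dird (du f) (base h) (t, s, u))))
    (at (t, s, u, p, q))"
    by (auto intro!: derivative_eq_intros hb)
qed (use assms in \<open>auto simp: jets1_def Dt0_eq Ck_on_2D simp del: Dt0.simps\<close>)
qed

lemma Ds0_has_derivative:
  assumes "open D" "Ck_on 2 D f" "(t, s, u) \<in> D" "q > 0"
  shows "(Ds0 f has_derivative (\<lambda>h. dird (ds f) (base h) (t, s, u)
      + (snd (snd (snd (snd h))) * du f (t, s, u) + q * dird (du f) (base h) (t, s, u))))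
    (at (t, s, u, p, q))"
proof -
  have hb: "((\<lambda>j. dird f v (base j)) has_derivative (\<lambda>h. dird (dird f v) (base h) (t, s, u)))
      (at (t, s, u, p, q))" for v
    using has_derivative_base[of "dird f v" "(t, s, u, p, q)"] Ck_on_2D(2)[OF assms(2,3)] by simp
  show ?thesis
  proof (rule has_derivative_transform_within_open[OF _ open_jets1[OF assms(1)]])
  show "((\<lambda>j. ds f (base j) + snd (snd (snd (snd j))) * du f (base j)) has_derivative
    (\<lambda>h. dird (ds f) (base h) (t, s, u)
      + (snd (snd (snd (snd h))) * du f (t, s, u) + q * dird (du f) (base h) (t, s, u))))
    (at (t, s, u, p, q))"
    by (auto intro!: derivative_eq_intros hb)
qed (use assms in \<open>auto simp: jets1_def Ds0_eq Ck_on_2D simp del: Ds0.simps\<close>)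
qed

text \<open>The second total derivative in t of a function of (t, s, u), with p and a for the first
  and second t-derivative of u; the mixed terms are merged by symmetry.\<close>

definition Dtt :: "(jet0 \<Rightarrow> real) \<Rightarrow> jet0 \<Rightarrow> real \<Rightarrow> real \<Rightarrow> real" where
  "Dtt f z p a = dt (dt f) z + 2 * p * dt (du f) z + p\<^sup>2 * du (du f) z + a * du f z"

definition Dss :: "(jet0 \<Rightarrow> real) \<Rightarrow> jet0 \<Rightarrow> real \<Rightarrow> real \<Rightarrow> real" where
  "Dss f z q c = ds (ds f) z + 2 * q * ds (du f) z + q\<^sup>2 * du (du f) z + c * du f z"

lemma Ck_on_components:
  assumes "open D" "Ck_on k D X"
  shows "Ck_on k D (xi_t X)" "Ck_on k D (xi_s X)" "Ck_on k D (eta X)"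
proof -
  have "bounded_linear (fst :: jet0 \<Rightarrow> real)" "bounded_linear (\<lambda>v::jet0. fst (snd v))"
    "bounded_linear (\<lambda>v::jet0. snd (snd v))"
    by (intro bounded_linear_compose[OF bounded_linear_fst]
      bounded_linear_compose[OF bounded_linear_snd] bounded_linear_fst bounded_linear_snd)+
  note * = this[THEN Ck_on_bounded_linear[OF assms(1) _ assms(2)]]
  show "Ck_on k D (xi_t X)" "Ck_on k D (xi_s X)" "Ck_on k D (eta X)"
    using * by (simp_all add: xi_t_def[abs_def] xi_s_def[abs_def] eta_def[abs_def])
qed

context
  fixes D :: "jet0 set" and X :: vfield
  assumes D: "open D" and X: "Ck_on 2 D X"
begin

lemmas C2 = Ck_on_components[OF D X]

lemma zeta_t_eq:
  assumes "(t, s, u) \<in> D"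
  shows "zeta_t X (t, s, u, p, q) = (let z = (t, s, u) in
    dt (eta X) z + p * du (eta X) z - p * (dt (xi_t X) z + p * du (xi_t X) z)
    - q * (dt (xi_s X) z + p * du (xi_s X) z))"
  using assms C2 by (simp add: Dt0_eq Ck_on_2D Let_def del: Dt0.simps)

lemma zeta_s_eq:
  assumes "(t, s, u) \<in> D"
  shows "zeta_s X (t, s, u, p, q) = (let z = (t, s, u) in
    ds (eta X) z + q * du (eta X) z - p * (ds (xi_t X) z + q * du (xi_t X) z)
    - q * (ds (xi_s X) z + q * du (xi_s X) z))"
  using assms C2 by (simp add: Ds0_eq Ck_on_2D Let_def del: Ds0.simps)

text \<open>The classical second prolongation formula. Each factor 2 collects one term from
  differentiating the factors p and q inside \<open>zeta_t\<close> and one from the recursion that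
  defines \<open>zeta_tt\<close>.\<close>

lemma zeta_tt_eq:
  assumes z: "(t, s, u) \<in> D" and "q > 0"
  shows "zeta_tt X (t, s, u, p, q, a, b, c) = (let z = (t, s, u) in
    Dtt (eta X) z p a - p * Dtt (xi_t X) z p a - q * Dtt (xi_s X) z p a
    - 2 * a * (dt (xi_t X) z + p * du (xi_t X) z) - 2 * b * (dt (xi_s X) z + p * du (xi_s X) z))"
proof -
  have eq: "zeta_t X = (\<lambda>j. Dt0 (eta X) j - fst (snd (snd (snd j))) * Dt0 (xi_t X) j
      - snd (snd (snd (snd j))) * Dt0 (xi_s X) j)"
    by (auto simp: fun_eq_iff Let_def)
  note h = C2[THEN Dt0_has_derivative[OF D _ assms]]
  have "(zeta_t X has_derivative (\<lambda>h.
      (dird (dt (eta X)) (base h) (t, s, u)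
        + (fst (snd (snd (snd h))) * du (eta X) (t, s, u) + p * dird (du (eta X)) (base h) (t, s, u)))
      - (fst (snd (snd (snd h))) * Dt0 (xi_t X) (t, s, u, p, q)
       + p * (dird (dt (xi_t X)) (base h) (t, s, u)
        + (fst (snd (snd (snd h))) * du (xi_t X) (t, s, u) + p * dird (du (xi_t X)) (base h) (t, s, u))))
      - (snd (snd (snd (snd h))) * Dt0 (xi_s X) (t, s, u, p, q)
       + q * (dird (dt (xi_s X)) (base h) (t, s, u)
        + (fst (snd (snd (snd h))) * du (xi_s X) (t, s, u) + p * dird (du (xi_s X)) (base h) (t, s, u))))))
     (at (t, s, u, p, q))"
    unfolding eq by (auto intro!: derivative_eq_intros h simp del: Dt0.simps simp: algebra_simps)
  note fd = frechet_derivative_at[OF this]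
  have c: "du (dt (eta X)) (t, s, u) = dt (du (eta X)) (t, s, u)"
    "du (dt (xi_t X)) (t, s, u) = dt (du (xi_t X)) (t, s, u)"
    "du (dt (xi_s X)) (t, s, u) = dt (du (xi_s X)) (t, s, u)"
    using dird_commute[OF D _ z] C2 by auto
  have e: "dird (dt f) (1, 0, p) (t, s, u) = dt (dt f) (t, s, u) + p * du (dt f) (t, s, u)"
    "dird (du f) (1, 0, p) (t, s, u) = dt (du f) (t, s, u) + p * du (du f) (t, s, u)"
    if "Ck_on 2 D f" for f
    using dird_coords[OF Ck_on_2D(2)[OF that z], of _ 1 0 p] by auto
  have "zeta_tt X (t, s, u, p, q, a, b, c) = frechet_derivative (zeta_t X) (at (t, s, u, p, q)) (1, 0, p, a, b)
     - a * Dt0 (xi_t X) (t, s, u, p, q) - b * Dt0 (xi_s X) (t, s, u, p, q)"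
    by (simp del: Dt0.simps zeta_t.simps)
  also have "\<dots> = (let z = (t, s, u) in
    Dtt (eta X) z p a - p * Dtt (xi_t X) z p a - q * Dtt (xi_s X) z p a
    - 2 * a * (dt (xi_t X) z + p * du (xi_t X) z) - 2 * b * (dt (xi_s X) z + p * du (xi_s X) z))"
    unfolding fd[symmetric] using C2 Dt0_eq[OF Ck_on_2D(1)[OF _ z]]
    by (simp add: e c Dtt_def Let_def algebra_simps power2_eq_square del: Dt0.simps)
  finally show ?thesis .
qed

lemma zeta_ss_eq:
  assumes z: "(t, s, u) \<in> D" and "q > 0"
  shows "zeta_ss X (t, s, u, p, q, a, b, c) = (let z = (t, s, u) in
    Dss (eta X) z q c - p * Dss (xi_t X) z q c - q * Dss (xi_s X) z q c
    - 2 * b * (ds (xi_t X) z + q * du (xi_t X) z) - 2 * c * (ds (xi_s X) z + q * du (xi_s X) z))"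
proof -
  have eq: "zeta_s X = (\<lambda>j. Ds0 (eta X) j - fst (snd (snd (snd j))) * Ds0 (xi_t X) j
      - snd (snd (snd (snd j))) * Ds0 (xi_s X) j)"
    by (auto simp: fun_eq_iff Let_def)
  note h = C2[THEN Ds0_has_derivative[OF D _ assms]]
  have "(zeta_s X has_derivative (\<lambda>h.
      (dird (ds (eta X)) (base h) (t, s, u)
        + (snd (snd (snd (snd h))) * du (eta X) (t, s, u) + q * dird (du (eta X)) (base h) (t, s, u)))
      - (fst (snd (snd (snd h))) * Ds0 (xi_t X) (t, s, u, p, q)
       + p * (dird (ds (xi_t X)) (base h) (t, s, u)
        + (snd (snd (snd (snd h))) * du (xi_t X) (t, s, u) + q * dird (du (xi_t X)) (base h) (t, s, u))))
      - (snd (snd (snd (snd h))) * Ds0 (xi_s X) (t, s, u, p, q)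
       + q * (dird (ds (xi_s X)) (base h) (t, s, u)
        + (snd (snd (snd (snd h))) * du (xi_s X) (t, s, u) + q * dird (du (xi_s X)) (base h) (t, s, u))))))
     (at (t, s, u, p, q))"
    unfolding eq by (auto intro!: derivative_eq_intros h simp del: Ds0.simps simp: algebra_simps)
  note fd = frechet_derivative_at[OF this]
  have c: "du (ds (eta X)) (t, s, u) = ds (du (eta X)) (t, s, u)"
    "du (ds (xi_t X)) (t, s, u) = ds (du (xi_t X)) (t, s, u)"
    "du (ds (xi_s X)) (t, s, u) = ds (du (xi_s X)) (t, s, u)"
    using dird_commute[OF D _ z] C2 by auto
  have e: "dird (ds f) (0, 1, q) (t, s, u) = ds (ds f) (t, s, u) + q * du (ds f) (t, s, u)"
    "dird (du f) (0, 1, q) (t, s, u) = ds (du f) (t, s, u) + q * du (du f) (t, s, u)"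
    if "Ck_on 2 D f" for f
    using dird_coords[OF Ck_on_2D(2)[OF that z], of _ 0 1 q] by auto
  have "zeta_ss X (t, s, u, p, q, a, b, c) = frechet_derivative (zeta_s X) (at (t, s, u, p, q)) (0, 1, q, b, c)
     - b * Ds0 (xi_t X) (t, s, u, p, q) - c * Ds0 (xi_s X) (t, s, u, p, q)"
    by (simp del: Ds0.simps zeta_s.simps)
  also have "\<dots> = (let z = (t, s, u) in
    Dss (eta X) z q c - p * Dss (xi_t X) z q c - q * Dss (xi_s X) z q c
    - 2 * b * (ds (xi_t X) z + q * du (xi_t X) z) - 2 * c * (ds (xi_s X) z + q * du (xi_s X) z))"
    unfolding fd[symmetric] using C2 Ds0_eq[OF Ck_on_2D(1)[OF _ z]]
    by (simp add: e c Dss_def Let_def algebra_simps power2_eq_square del: Ds0.simps)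
  finally show ?thesis .
qed

end

section \<open>Derivatives of the gas dynamics expressions\<close>

text \<open>For n = 0 the function is constant and the factor \<open>real n\<close> annihilates the
  right side, also at u = 0, where the quotient is 0 by convention. This lets plane flows have a
  domain with arbitrary real u.\<close>

lemma phipow_deriv:
  assumes "n = 0 \<or> u > 0"
  shows "(phipow n \<gamma> has_real_derivative real n * (1 - \<gamma>) * phipow n \<gamma> u / u) (at u)"
proof (cases "n = 0")
  case True
  then show ?thesis by (simp add: phipow_def[abs_def])
next
  case False
  then have u: "u > 0" using assms by simp
  have "(phipow n \<gamma> has_real_derivative
      real n * (u powr (1 - \<gamma>)) ^ (n - 1) * ((1 - \<gamma>) * u powr (1 - \<gamma> - 1))) (at u)"
    unfolding phipow_def[abs_def]
    using DERIV_power[OF has_real_derivative_powr[OF u, of "1 - \<gamma>"], of n] by (simp add: mult_ac)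
  moreover have "u powr (1 - \<gamma> - 1) = u powr (1 - \<gamma>) / u"
    using u by (subst powr_diff) simp
  moreover have "(u powr (1 - \<gamma>)) ^ n = (u powr (1 - \<gamma>)) ^ (n - 1) * u powr (1 - \<gamma>)"
    using False by (cases n) auto
  ultimately show ?thesis by (simp add: phipow_def mult_ac)
qed

lemma phipow_pos: "n = 0 \<or> u > 0 \<Longrightarrow> phipow n \<gamma> u > 0"
  by (auto simp: phipow_def)

lemma powr_1_minus: "q > 0 \<Longrightarrow> q powr (1 - \<gamma>) = q * q powr (- \<gamma>)" for q :: real
  by (metis powr_mult_base add_uminus_conv_diff less_eq_real_def)

lemma powr_minus_deriv:
  assumes "q > 0"
  shows "((\<lambda>q. q powr (- \<gamma>)) has_real_derivative - \<gamma> * q powr (- \<gamma>) / q) (at q)"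
proof -
  have "q powr (- \<gamma> - 1) = q powr (- \<gamma>) / q" using assms by (subst powr_diff) simp
  then show ?thesis using assms by (auto intro!: derivative_eq_intros)
qed

lemma gas_has_derivative:
  fixes \<gamma> :: real
  assumes u: "n = 0 \<or> u > 0" and q: "q > 0"
    and S: "(S has_real_derivative deriv S s) (at s)"
      "(deriv S has_real_derivative S2) (at s)"
  defines "W \<equiv> phipow n \<gamma> u * q powr (- \<gamma>)"
  shows "(gas n \<gamma> S has_derivative (\<lambda>(t', s', u', p', q', a', b', c'). a' +
      W * (s' * (S2 - real n * \<gamma> * deriv S s * (q / u) - \<gamma> * deriv S s * (c / q))
        + u' * (real n * (1 - \<gamma>) / u * (deriv S s - real n * \<gamma> * S s * (q / u) - \<gamma> * S s * (c / q))
            + real n * \<gamma> * S s * q / u\<^sup>2)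
        + q' * (- \<gamma> / q * (deriv S s - real n * \<gamma> * S s * (q / u) - \<gamma> * S s * (c / q))
            - real n * \<gamma> * S s / u + \<gamma> * S s * c / q\<^sup>2)
        - c' * (\<gamma> * S s / q)))) (at (t, s, u, p, q, a, b, c))"
proof -
  let ?j = "(t, s, u, p, q, a, b, c)"
  define ps where "ps j = fst (snd j)" for j :: jet2
  define pu where "pu j = fst (snd (snd j))" for j :: jet2
  define pq where "pq j = fst (snd (snd (snd (snd j))))" for j :: jet2
  define pa where "pa j = fst (snd (snd (snd (snd (snd j)))))" for j :: jet2
  define pc where "pc j = snd (snd (snd (snd (snd (snd (snd j))))))" for j :: jet2
  note pd = ps_def pu_def pq_def pa_def pc_def
  have val: "ps ?j = s" "pu ?j = u" "pq ?j = q" "pa ?j = a" "pc ?j = c" by (auto simp: pd)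
  \<comment> \<open>The factor \<open>real n\<close> is attached to the quotient q/u: for n = 0 the
    product is constantly 0 and hence differentiable even at u = 0.\<close>
  have eq: "gas n \<gamma> S = (\<lambda>j. pa j + phipow n \<gamma> (pu j) * pq j powr (- \<gamma>) *
      (deriv S (ps j) - \<gamma> * S (ps j) * (real n * (pq j / pu j)) - \<gamma> * S (ps j) * (pc j / pq j)))"
    by (auto simp: fun_eq_iff pd)
  have h: "(ps has_derivative ps) (at ?j)" "(pu has_derivative pu) (at ?j)"
    "(pq has_derivative pq) (at ?j)" "(pa has_derivative pa) (at ?j)" "(pc has_derivative pc) (at ?j)"
    unfolding pd by (auto intro!: derivative_eq_intros)
  have hS: "((\<lambda>j. S (ps j)) has_derivative (\<lambda>h. ps h * deriv S s)) (at ?j)"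
    "((\<lambda>j. deriv S (ps j)) has_derivative (\<lambda>h. ps h * S2)) (at ?j)"
    using DERIV_compose_FDERIV[OF _ h(1)] S val by auto
  have hP: "((\<lambda>j. phipow n \<gamma> (pu j)) has_derivative
      (\<lambda>h. pu h * (real n * (1 - \<gamma>) * phipow n \<gamma> u / u))) (at ?j)"
    by (rule DERIV_compose_FDERIV[OF _ h(2), unfolded val, OF phipow_deriv[OF u]])
  have hQ: "((\<lambda>j. pq j powr (- \<gamma>)) has_derivative (\<lambda>h. pq h * (- \<gamma> * q powr (- \<gamma>) / q))) (at ?j)"
    by (rule DERIV_compose_FDERIV[OF _ h(3), unfolded val, OF powr_minus_deriv[OF q]])
  have hr: "((\<lambda>j. real n * (pq j / pu j)) has_derivative
      (\<lambda>h. real n * (pq h / u - q * pu h / u\<^sup>2))) (at ?j)"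
  proof (cases "n = 0")
    case False
    then have "u > 0" using u by simp
    then show ?thesis using h val
      by (auto intro!: derivative_eq_intros simp: field_simps power2_eq_square)
  qed simp
  have hc: "((\<lambda>j. pc j / pq j) has_derivative (\<lambda>h. pc h / q - c * pq h / q\<^sup>2)) (at ?j)"
    using h val q by (auto intro!: derivative_eq_intros simp: field_simps power2_eq_square)
  show ?thesis
    unfolding eq
    apply (rule has_derivative_eq_rhs)
     apply (rule h hS hP hQ hr hc has_derivative_add has_derivative_diff has_derivative_mult has_derivative_const)+
    apply (rule ext)
    apply (simp add: val W_def pd case_prod_beta)
    apply (simp add: divide_inverse power2_eq_square algebra_simps)
    done
qed

lemma Ck_on_2_real:
  fixes S :: "real \<Rightarrow> real"
  assumes "Ck_on 2 UNIV S"
  shows "(S has_real_derivative deriv S x) (at x)"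
    and "(deriv S has_real_derivative deriv (deriv S) x) (at x)"
proof -
  have 1: "S differentiable (at x)" for x using Ck_on_2D(1)[OF assms] by simp
  then have S: "(S has_real_derivative deriv S x) (at x)" for x
    by (metis DERIV_deriv_iff_real_differentiable)
  then show "(S has_real_derivative deriv S x) (at x)" .
  have "deriv S = dird S 1"
  proof
    fix x show "deriv S x = dird S 1 x"
      using dird_eqI[OF S[of x, unfolded has_field_derivative_def], of 1] by simp
  qed
  then have "deriv S differentiable (at x)" using Ck_on_2D(2)[OF assms] by simp
  then show "(deriv S has_real_derivative deriv (deriv S) x) (at x)"
    by (metis DERIV_deriv_iff_real_differentiable)
qed

section \<open>Conservation laws\<close>

text \<open>Every density is a polynomial in t, u, p and these two functions, the internal energy
  part of the Lagrangian and its derivative with respect to \<open>\<phi>\<^sub>s\<close>, so their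
  derivatives are computed once for all laws.\<close>

fun potential :: "nat \<Rightarrow> real \<Rightarrow> (real \<Rightarrow> real) \<Rightarrow> jet1 \<Rightarrow> real" where
  "potential n \<gamma> S (t, s, u, p, q) = S s / (\<gamma> - 1) * phipow n \<gamma> u * q powr (1 - \<gamma>)"

fun flux :: "nat \<Rightarrow> real \<Rightarrow> (real \<Rightarrow> real) \<Rightarrow> jet1 \<Rightarrow> real" where
  "flux n \<gamma> S (t, s, u, p, q) = S s * phipow n \<gamma> u * q powr (- \<gamma>)"

locale gas_equation =
  fixes n :: nat and \<gamma> :: real and S :: "real \<Rightarrow> real" and D :: "jet0 set"
  assumes \<gamma>: "\<gamma> > 1" and S: "Ck_on 2 UNIV S" and D: "open D"
    and upos: "n \<noteq> 0 \<Longrightarrow> D \<subseteq> {(t, s, u). u > 0}"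
begin

abbreviation "L \<equiv> lagrangian n \<gamma> S"
abbreviation "F \<equiv> gas n \<gamma> S"

lemma upos': "(t, s, u) \<in> D \<Longrightarrow> n = 0 \<or> u > 0"
  using upos by auto

text \<open>The common power factor of all terms with S. Kept opaque, it turns the conservation laws
  and determining equations into rational identities.\<close>

definition W where "W u q = phipow n \<gamma> u * q powr (- \<gamma>)"

lemma potential_W: "q > 0 \<Longrightarrow> potential n \<gamma> S (t, s, u, p, q) = S s * W u q * q / (\<gamma> - 1)"
  and flux_W: "flux n \<gamma> S (t, s, u, p, q) = S s * W u q"
  by (simp_all add: W_def powr_1_minus)

definition dpotential where "dpotential s u q h = W u q *
  (fst (snd h) * deriv S s * q / (\<gamma> - 1) - fst (snd (snd h)) * (real n * S s * q / u)
    - snd (snd (snd (snd h))) * S s)" for h :: jet1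

definition dflux where "dflux s u q h = W u q *
  (fst (snd h) * deriv S s + fst (snd (snd h)) * (real n * (1 - \<gamma>) * S s / u)
    - snd (snd (snd (snd h))) * (\<gamma> * S s / q))" for h :: jet1

lemma potential_flux_has_derivative:
  assumes "(t, s, u, p, q) \<in> jets1 D"
  shows "(potential n \<gamma> S has_derivative dpotential s u q) (at (t, s, u, p, q))"
    and "(flux n \<gamma> S has_derivative dflux s u q) (at (t, s, u, p, q))"
proof -
  let ?j = "(t, s, u, p, q)"
  have z: "(t, s, u) \<in> D" and q: "q > 0" using assms by (auto simp: mem_jets1)
  define ps where "ps j = fst (snd j)" for j :: jet1
  define pu where "pu j = fst (snd (snd j))" for j :: jet1
  define pq where "pq j = snd (snd (snd (snd j)))" for j :: jet1
  note pd = ps_def pu_def pq_def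
  have val: "ps ?j = s" "pu ?j = u" "pq ?j = q" by (auto simp: pd)
  have h: "(ps has_derivative ps) (at ?j)" "(pu has_derivative pu) (at ?j)"
    "(pq has_derivative pq) (at ?j)"
    unfolding pd by (auto intro!: derivative_eq_intros)
  have hS: "((\<lambda>j. S (ps j)) has_derivative (\<lambda>h. ps h * deriv S s)) (at ?j)"
    by (rule DERIV_compose_FDERIV[OF _ h(1), unfolded val, OF Ck_on_2_real(1)[OF S]])
  have hP: "((\<lambda>j. phipow n \<gamma> (pu j)) has_derivative
      (\<lambda>h. pu h * (real n * (1 - \<gamma>) * phipow n \<gamma> u / u))) (at ?j)"
    by (rule DERIV_compose_FDERIV[OF _ h(2), unfolded val, OF phipow_deriv[OF upos'[OF z]]])
  have hQ: "((\<lambda>j. pq j powr (- \<gamma>)) has_derivative (\<lambda>h. pq h * (- \<gamma> * q powr (- \<gamma>) / q))) (at ?j)"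
    by (rule DERIV_compose_FDERIV[OF _ h(3), unfolded val, OF powr_minus_deriv[OF q]])
  have fl: "flux n \<gamma> S = (\<lambda>j. S (ps j) * phipow n \<gamma> (pu j) * pq j powr (- \<gamma>))"
    by (auto simp: fun_eq_iff pd)
  show flux: "(flux n \<gamma> S has_derivative dflux s u q) (at ?j)"
    unfolding fl
    apply (rule has_derivative_eq_rhs)
     apply (rule h hS hP hQ has_derivative_mult)+
    apply (rule ext)
    apply (simp add: val W_def pd dflux_def)
    apply (simp add: divide_inverse algebra_simps)
    done
  \<comment> \<open>For q > 0 the potential is the flux times q / (\<gamma> - 1), so its derivative
    follows from that of the flux by the product rule.\<close>
  have "((\<lambda>j. flux n \<gamma> S j * pq j * inverse (\<gamma> - 1)) has_derivative dpotential s u q) (at ?j)"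
    apply (rule has_derivative_eq_rhs)
     apply (rule flux h has_derivative_mult has_derivative_const)+
    apply (rule ext)
    apply (simp add: val dpotential_def dflux_def flux_W pd del: flux.simps)
    using q \<gamma> apply (simp add: divide_simps)
    apply (simp add: algebra_simps)
    done
  then show "(potential n \<gamma> S has_derivative dpotential s u q) (at ?j)"
    by (rule has_derivative_transform_within_open[OF _ open_jets1[OF D] assms])
      (auto simp: mem_jets1 potential_W flux_W pd divide_inverse simp del: potential.simps flux.simps)
qed

lemma L_eq: "L = (\<lambda>j. (fst (snd (snd (snd j))))\<^sup>2 / 2 - potential n \<gamma> S j)"
  by (auto simp: fun_eq_iff)

lemma L_has_derivative:
  assumes "(t, s, u, p, q) \<in> jets1 D"
  shows "(L has_derivative (\<lambda>h. p * fst (snd (snd (snd h))) - dpotential s u q h)) (at (t, s, u, p, q))"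
proof -
  have "((\<lambda>j. (fst (snd (snd (snd j))))\<^sup>2 / 2) has_derivative (\<lambda>h. p * fst (snd (snd (snd h)))))
      (at (t, s, u, p, q))"
    by (auto intro!: derivative_eq_intros)
  from has_derivative_diff[OF this potential_flux_has_derivative(1)[OF assms]]
  show ?thesis unfolding L_eq .
qed

lemma d_L:
  assumes "(t, s, u, p, q) \<in> jets1 D"
  shows "d_phi L (t, s, u, p, q) = W u q * (real n * S s * q / u)"
    and "d_phit L (t, s, u, p, q) = p"
    and "d_phis L (t, s, u, p, q) = flux n \<gamma> S (t, s, u, p, q)"
  unfolding d_phi_def d_phit_def d_phis_def frechet_derivative_at[OF L_has_derivative[OF assms], symmetric]
  by (simp_all add: dpotential_def flux_W del: flux.simps)

text \<open>The partial derivatives of \<open>L\<close> are known in closed form over the open set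
  \<open>jets1 D\<close>, which suffices to differentiate them there. The sign appears because
  \<open>F\<close> contains the second t-derivative of u with coefficient +1.\<close>

lemma euler_lagrange_eq:
  assumes "(t, s, u, p, q, a, b, c) \<in> jets2 D"
  shows "euler_lagrange L (t, s, u, p, q, a, b, c) = - F (t, s, u, p, q, a, b, c)"
proof -
  let ?j = "(t, s, u, p, q)"
  have j: "?j \<in> jets1 D" using assms by (simp add: jets2_def)
  have "((\<lambda>j. fst (snd (snd (snd j)))) has_derivative (\<lambda>h. fst (snd (snd (snd h))))) (at ?j)"
    by (auto intro!: derivative_eq_intros)
  then have "(d_phit L has_derivative (\<lambda>h. fst (snd (snd (snd h))))) (at ?j)"
    by (rule has_derivative_transform_within_open[OF _ open_jets1[OF D] j]) (auto simp: d_L)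
  from frechet_derivative_at[OF this]
  have 1: "Dt1 (d_phit L) (t, s, u, p, q, a, b, c) = a"
    by (metis Dt1.simps fst_conv snd_conv)
  have "(d_phis L has_derivative dflux s u q) (at ?j)"
    by (rule has_derivative_transform_within_open[OF potential_flux_has_derivative(2)[OF j] open_jets1[OF D] j])
      (auto simp: d_L simp del: flux.simps)
  from frechet_derivative_at[OF this]
  have "Ds1 (d_phis L) (t, s, u, p, q, a, b, c) = dflux s u q (0, 1, q, b, c)"
    by (metis Ds1.simps)
  with 1 show ?thesis
    using d_L(1)[OF j]
    by (simp add: euler_lagrange_def dflux_def W_def[symmetric] divide_inverse algebra_simps)
qed

text \<open>The equation is solved for a, so the jets of solutions are parametrised by the remaining
  coordinates and conservation becomes an identity in free variables.\<close>

lemma conservation_lawI: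
  assumes "\<And>t s u p q. (t, s, u, p, q) \<in> jets1 D \<Longrightarrow> (Tt has_derivative Tt' t s u p q) (at (t, s, u, p, q))"
    and "\<And>t s u p q. (t, s, u, p, q) \<in> jets1 D \<Longrightarrow> (Ts has_derivative Ts' t s u p q) (at (t, s, u, p, q))"
    and "\<And>t s u p q a b c. (t, s, u) \<in> D \<Longrightarrow> q > 0 \<Longrightarrow> n = 0 \<or> u > 0 \<Longrightarrow>
      a = - (W u q * (deriv S s - real n * \<gamma> * S s * (q / u) - \<gamma> * S s * (c / q))) \<Longrightarrow>
      Tt' t s u p q (1, 0, p, a, b) + Ts' t s u p q (0, 1, q, b, c) = 0"
  shows "conservation_law D F Tt Ts"
  unfolding conservation_law_def
proof (intro conjI ballI impI)
  fix j assume j: "j \<in> jets1 D"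
  obtain t s u p q where jj: "j = (t, s, u, p, q)" by (cases j)
  show "Tt differentiable (at j)" "Ts differentiable (at j)"
    using assms(1,2)[OF j[unfolded jj]] unfolding jj differentiable_def by blast+
next
  fix j assume j: "j \<in> jets2 D" "F j = 0"
  obtain t s u p q a b c where jj: "j = (t, s, u, p, q, a, b, c)"
    by (cases j; cases "snd (snd (snd (snd (snd (snd j)))))") auto
  then have z: "(t, s, u) \<in> D" "q > 0" and j1: "(t, s, u, p, q) \<in> jets1 D"
    using j by (auto simp: mem_jets2 mem_jets1)
  have "a = - (W u q * (deriv S s - real n * \<gamma> * S s * (q / u) - \<gamma> * S s * (c / q)))"
    using j(2) by (simp add: jj W_def)
  from assms(3)[OF z upos'[OF z(1)] this, of p b]
  show "Dt1 Tt j + Ds1 Ts j = 0"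
    unfolding jj Dt1.simps Ds1.simps
    unfolding frechet_derivative_at[OF assms(1)[OF j1], symmetric]
      frechet_derivative_at[OF assms(2)[OF j1], symmetric] .
qed

lemma energy_eq:
  "energy_t n \<gamma> S = (\<lambda>j. (fst (snd (snd (snd j))))\<^sup>2 / 2 + potential n \<gamma> S j)"
  "energy_s n \<gamma> S = (\<lambda>j. fst (snd (snd (snd j))) * flux n \<gamma> S j)"
  by (auto simp: fun_eq_iff)

lemma energy_has_derivative:
  assumes "(t, s, u, p, q) \<in> jets1 D"
  shows "(energy_t n \<gamma> S has_derivative (\<lambda>h. p * fst (snd (snd (snd h))) + dpotential s u q h)) (at (t, s, u, p, q))"
    "(energy_s n \<gamma> S has_derivative (\<lambda>h. p * dflux s u q h + fst (snd (snd (snd h))) * flux n \<gamma> S (t, s, u, p, q)))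
      (at (t, s, u, p, q))"
proof -
  have p2: "((\<lambda>j. (fst (snd (snd (snd j))))\<^sup>2 / 2) has_derivative (\<lambda>h. p * fst (snd (snd (snd h)))))
      (at (t, s, u, p, q))"
    by (auto intro!: derivative_eq_intros)
  show "(energy_t n \<gamma> S has_derivative (\<lambda>h. p * fst (snd (snd (snd h))) + dpotential s u q h)) (at (t, s, u, p, q))"
    unfolding energy_eq by (intro has_derivative_add p2 potential_flux_has_derivative assms)
  show "(energy_s n \<gamma> S has_derivative (\<lambda>h. p * dflux s u q h + fst (snd (snd (snd h))) * flux n \<gamma> S (t, s, u, p, q)))
      (at (t, s, u, p, q))"
    unfolding energy_eq
    by (rule has_derivative_eq_rhs, (rule potential_flux_has_derivative(2)[OF assms] has_derivative_add has_derivative_diff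
      has_derivative_mult has_derivative_minus has_derivative_const has_derivative_power
      has_derivative_fst has_derivative_snd has_derivative_ident)+,
      simp add: fun_eq_iff algebra_simps del: potential.simps flux.simps energy_t.simps energy_s.simps)
qed

lemma energy_conserved: "conservation_law D F (energy_t n \<gamma> S) (energy_s n \<gamma> S)"
proof (rule conservation_lawI[OF energy_has_derivative])
  fix t s u p q a b c :: real
  assume *: "(t, s, u) \<in> D" "q > 0" "n = 0 \<or> u > 0"
    "a = - (W u q * (deriv S s - real n * \<gamma> * S s * (q / u) - \<gamma> * S s * (c / q)))"
  show "p * fst (snd (snd (snd (1::real, 0::real, p, a, b)))) + dpotential s u q (1, 0, p, a, b) +
    (p * dflux s u q (0, 1, q, b, c) + fst (snd (snd (snd (0::real, 1::real, q, b, c)))) * flux n \<gamma> S (t, s, u, p, q)) = 0"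
    by (simp add: * dpotential_def dflux_def flux_W divide_inverse algebra_simps del: flux.simps)
qed

lemma momentum_conserved:
  assumes "n = 0"
  shows "conservation_law D F momentum_t (momentum_s \<gamma> S)"
proof (rule conservation_lawI)
  have 1: "momentum_t = (\<lambda>j. fst (snd (snd (snd j))))"
    and 2: "momentum_s \<gamma> S = flux n \<gamma> S" using assms by (auto simp: fun_eq_iff phipow_def)
  fix t s u p q assume *: "(t, s, u, p, q) \<in> jets1 D"
  show "(momentum_t has_derivative (\<lambda>h. fst (snd (snd (snd h))))) (at (t, s, u, p, q))"
    unfolding 1
    by (rule has_derivative_eq_rhs, (rule energy_has_derivative[OF *] potential_flux_has_derivative(2)[OF *] has_derivative_add has_derivative_diff
      has_derivative_mult has_derivative_minus has_derivative_const has_derivative_power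
      has_derivative_fst has_derivative_snd has_derivative_ident)+,
      simp add: fun_eq_iff algebra_simps del: potential.simps flux.simps energy_t.simps energy_s.simps)
  show "(momentum_s \<gamma> S has_derivative dflux s u q) (at (t, s, u, p, q))"
    unfolding 2 using * by (rule potential_flux_has_derivative)
qed (simp add: dflux_def flux_W divide_inverse algebra_simps del: flux.simps, simp add: assms)

lemma center_conserved:
  assumes "n = 0"
  shows "conservation_law D F center_t (center_s \<gamma> S)"
proof (rule conservation_lawI)
  have 1: "center_t = (\<lambda>j. fst (snd (snd j)) - fst j * fst (snd (snd (snd j))))"
    and 2: "center_s \<gamma> S = (\<lambda>j. - fst j * flux n \<gamma> S j)" using assms by (auto simp: fun_eq_iff phipow_def)
  fix t s u p q assume *: "(t, s, u, p, q) \<in> jets1 D"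
  show "(center_t has_derivative (\<lambda>h. fst (snd (snd h)) - (t * fst (snd (snd (snd h))) + fst h * p))) (at (t, s, u, p, q))"
    unfolding 1
    by (rule has_derivative_eq_rhs, (rule energy_has_derivative[OF *] potential_flux_has_derivative(2)[OF *] has_derivative_add has_derivative_diff
      has_derivative_mult has_derivative_minus has_derivative_const has_derivative_power
      has_derivative_fst has_derivative_snd has_derivative_ident)+,
      simp add: fun_eq_iff algebra_simps del: potential.simps flux.simps energy_t.simps energy_s.simps)
  show "(center_s \<gamma> S has_derivative (\<lambda>h. - t * dflux s u q h + - fst h * flux n \<gamma> S (t, s, u, p, q))) (at (t, s, u, p, q))"
    unfolding 2
    by (rule has_derivative_eq_rhs, (rule energy_has_derivative[OF *] potential_flux_has_derivative(2)[OF *] has_derivative_add has_derivative_diff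
      has_derivative_mult has_derivative_minus has_derivative_const has_derivative_power
      has_derivative_fst has_derivative_snd has_derivative_ident)+,
      simp add: fun_eq_iff algebra_simps del: potential.simps flux.simps energy_t.simps energy_s.simps)
next
  fix t s u p q a b c :: real
  assume *: "(t, s, u) \<in> D" "q > 0" "n = 0 \<or> u > 0"
    "a = - (W u q * (deriv S s - real n * \<gamma> * S s * (q / u) - \<gamma> * S s * (c / q)))"
  \<comment> \<open>The momentum balance. The center of mass law is -t times it, since
    differentiating the factor t in \<open>center_t\<close> cancels the total t-derivative of
    u.\<close>
  have "a + dflux s u q (0, 1, q, b, c) = 0"
    unfolding dflux_def *(4) using assms by (simp add: algebra_simps)
  then have "t * (a + dflux s u q (0, 1, q, b, c)) = 0" by simp
  then show "fst (snd (snd (1::real, 0::real, p, a, b))) - (t * fst (snd (snd (snd (1::real, 0::real, p, a, b))))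
      + fst (1::real, 0::real, p, a, b) * p)
    + (- t * dflux s u q (0, 1, q, b, c) + - fst (0::real, 1::real, q, b, c) * flux n \<gamma> S (t, s, u, p, q)) = 0"
    by (simp add: algebra_simps del: flux.simps)
qed

lemma \<gamma>_star_eq: "\<gamma> = gamma_star n \<Longrightarrow> (real n + 1) * (\<gamma> - 1) = 2"
  by (simp add: gamma_star_def field_simps)

text \<open>At the special exponent 1 / (\<gamma> - 1) equals (n + 1) / 2. The resulting
  proportionality makes the energy terms cancel in the scaling and projective laws.\<close>

lemma potential_flux_star:
  assumes "\<gamma> = gamma_star n" "q > 0"
  shows "2 * potential n \<gamma> S (t, s, u, p, q) = (real n + 1) * q * flux n \<gamma> S (t, s, u, p, q)"
proof -
  have "2 / (\<gamma> - 1) = real n + 1" using \<gamma>_star_eq[OF assms(1)] \<gamma> by (simp add: field_simps)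
  then have "2 * (S s * W u q * q / (\<gamma> - 1)) = (real n + 1) * q * (S s * W u q)"
    by (metis (no_types, opaque_lifting) mult.commute mult.left_commute times_divide_eq_right)
  then show ?thesis unfolding potential_W[OF assms(2)] flux_W .
qed

lemma scaling_conserved:
  assumes "\<gamma> = gamma_star n"
  shows "conservation_law D F (scaling_t n \<gamma> S) (scaling_s n \<gamma> S)"
proof (rule conservation_lawI)
  have 1: "scaling_t n \<gamma> S = (\<lambda>j. - 2 * fst j * energy_t n \<gamma> S j + fst (snd (snd j)) * fst (snd (snd (snd j))))"
    and 2: "scaling_s n \<gamma> S = (\<lambda>j. - 2 * fst j * energy_s n \<gamma> S j + fst (snd (snd j)) * flux n \<gamma> S j)"
    by (auto simp: fun_eq_iff algebra_simps)
  fix t s u p q assume *: "(t, s, u, p, q) \<in> jets1 D"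
  show "(scaling_t n \<gamma> S has_derivative (\<lambda>h. - 2 * t * (p * fst (snd (snd (snd h))) + dpotential s u q h)
       + - 2 * fst h * energy_t n \<gamma> S (t, s, u, p, q)
       + (u * fst (snd (snd (snd h))) + fst (snd (snd h)) * p))) (at (t, s, u, p, q))"
    unfolding 1
    by (rule has_derivative_eq_rhs, (rule energy_has_derivative[OF *] potential_flux_has_derivative(2)[OF *] has_derivative_add has_derivative_diff
      has_derivative_mult has_derivative_minus has_derivative_const has_derivative_power
      has_derivative_fst has_derivative_snd has_derivative_ident)+,
      simp add: fun_eq_iff algebra_simps del: potential.simps flux.simps energy_t.simps energy_s.simps)
  show "(scaling_s n \<gamma> S has_derivative (\<lambda>h. - 2 * t * (p * dflux s u q h + fst (snd (snd (snd h))) * flux n \<gamma> S (t, s, u, p, q))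
       + - 2 * fst h * energy_s n \<gamma> S (t, s, u, p, q)
       + (u * dflux s u q h + fst (snd (snd h)) * flux n \<gamma> S (t, s, u, p, q)))) (at (t, s, u, p, q))"
    unfolding 2
    by (rule has_derivative_eq_rhs, (rule energy_has_derivative[OF *] potential_flux_has_derivative(2)[OF *] has_derivative_add has_derivative_diff
      has_derivative_mult has_derivative_minus has_derivative_const has_derivative_power
      has_derivative_fst has_derivative_snd has_derivative_ident)+,
      simp add: fun_eq_iff algebra_simps del: potential.simps flux.simps energy_t.simps energy_s.simps)
next
  fix t s u p q a b c :: real
  assume *: "(t, s, u) \<in> D" "q > 0" "n = 0 \<or> u > 0"
    "a = - (W u q * (deriv S s - real n * \<gamma> * S s * (q / u) - \<gamma> * S s * (c / q)))"
  \<comment> \<open>\<open>E\<close> is the energy balance, \<open>V\<close> the ratio of potential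
    and flux at the special exponent, and \<open>M\<close> is u times the equation. By
    \<open>V\<close> and \<open>M\<close> everything in the divergence cancels except -2 t times the
    left side of \<open>E\<close>.\<close>
  have E: "p * a + dpotential s u q (1, 0, p, a, b) + (p * dflux s u q (0, 1, q, b, c) + b * flux n \<gamma> S (t, s, u, p, q)) = 0"
    by (simp add: * dpotential_def dflux_def flux_W divide_inverse algebra_simps del: flux.simps)
  have V: "2 * energy_t n \<gamma> S (t, s, u, p, q) = p\<^sup>2 + (real n + 1) * q * flux n \<gamma> S (t, s, u, p, q)"
    using potential_flux_star[OF assms *(2), of t s u p] by (simp add: energy_eq del: flux.simps potential.simps)
  \<comment> \<open>Multiplication by u removes the division by u. The case u = 0 can occur only for
    n = 0, where both sides vanish.\<close>
  have M: "u * a + u * dflux s u q (0, 1, q, b, c) = real n * q * flux n \<gamma> S (t, s, u, p, q)"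
    using *(2,3) by (cases "u = 0") (auto simp: *(4) dflux_def flux_W field_simps simp del: flux.simps)
  show "- 2 * t * (p * fst (snd (snd (snd (1::real, 0::real, p, a, b)))) + dpotential s u q (1, 0, p, a, b))
       + - 2 * fst (1::real, 0::real, p, a, b) * energy_t n \<gamma> S (t, s, u, p, q)
       + (u * fst (snd (snd (snd (1::real, 0::real, p, a, b)))) + fst (snd (snd (1::real, 0::real, p, a, b))) * p)
      + (- 2 * t * (p * dflux s u q (0, 1, q, b, c) + fst (snd (snd (snd (0::real, 1::real, q, b, c)))) * flux n \<gamma> S (t, s, u, p, q))
       + - 2 * fst (0::real, 1::real, q, b, c) * energy_s n \<gamma> S (t, s, u, p, q)
       + (u * dflux s u q (0, 1, q, b, c) + fst (snd (snd (0::real, 1::real, q, b, c))) * flux n \<gamma> S (t, s, u, p, q))) = 0"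
    using E V M by (simp del: energy_t.simps energy_s.simps flux.simps) algebra
qed

lemma proj_conserved:
  assumes "\<gamma> = gamma_star n"
  shows "conservation_law D F (proj_t n \<gamma> S) (proj_s n \<gamma> S)"
proof (rule conservation_lawI)
  have 1: "proj_t n \<gamma> S = (\<lambda>j. - (fst j)\<^sup>2 * energy_t n \<gamma> S j + fst j * (fst (snd (snd j)) * fst (snd (snd (snd j)))) - (fst (snd (snd j)))\<^sup>2 * (1 / 2))"
    and 2: "proj_s n \<gamma> S = (\<lambda>j. - (fst j)\<^sup>2 * energy_s n \<gamma> S j + fst j * (fst (snd (snd j)) * flux n \<gamma> S j))"
    by (auto simp: fun_eq_iff algebra_simps)
  fix t s u p q assume *: "(t, s, u, p, q) \<in> jets1 D"
  show "(proj_t n \<gamma> S has_derivative (\<lambda>h. - t\<^sup>2 * (p * fst (snd (snd (snd h))) + dpotential s u q h)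
       + - 2 * t * fst h * energy_t n \<gamma> S (t, s, u, p, q)
       + (t * (u * fst (snd (snd (snd h))) + fst (snd (snd h)) * p) + fst h * (u * p)) - u * fst (snd (snd h)))) (at (t, s, u, p, q))"
    unfolding 1
    by (rule has_derivative_eq_rhs, (rule energy_has_derivative[OF *] potential_flux_has_derivative(2)[OF *] has_derivative_add has_derivative_diff
      has_derivative_mult has_derivative_minus has_derivative_const has_derivative_power
      has_derivative_fst has_derivative_snd has_derivative_ident)+,
      simp add: fun_eq_iff algebra_simps del: potential.simps flux.simps energy_t.simps energy_s.simps)
  show "(proj_s n \<gamma> S has_derivative (\<lambda>h. - t\<^sup>2 * (p * dflux s u q h + fst (snd (snd (snd h))) * flux n \<gamma> S (t, s, u, p, q))
       + - 2 * t * fst h * energy_s n \<gamma> S (t, s, u, p, q)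
       + (t * (u * dflux s u q h + fst (snd (snd h)) * flux n \<gamma> S (t, s, u, p, q)) + fst h * (u * flux n \<gamma> S (t, s, u, p, q))))) (at (t, s, u, p, q))"
    unfolding 2
    by (rule has_derivative_eq_rhs, (rule energy_has_derivative[OF *] potential_flux_has_derivative(2)[OF *] has_derivative_add has_derivative_diff
      has_derivative_mult has_derivative_minus has_derivative_const has_derivative_power
      has_derivative_fst has_derivative_snd has_derivative_ident)+,
      simp add: fun_eq_iff algebra_simps del: potential.simps flux.simps energy_t.simps energy_s.simps)
next
  fix t s u p q a b c :: real
  assume *: "(t, s, u) \<in> D" "q > 0" "n = 0 \<or> u > 0"
    "a = - (W u q * (deriv S s - real n * \<gamma> * S s * (q / u) - \<gamma> * S s * (c / q)))"
  \<comment> \<open>The divergence is \<open>-t\<^sup>2\<close> times the energy balance: the terms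
    linear in t cancel by \<open>V\<close> and \<open>M\<close>, and u p from the factor t cancels
    the derivative of \<open>u\<^sup>2 / 2\<close>.\<close>
  have E: "p * a + dpotential s u q (1, 0, p, a, b) + (p * dflux s u q (0, 1, q, b, c) + b * flux n \<gamma> S (t, s, u, p, q)) = 0"
    by (simp add: * dpotential_def dflux_def flux_W divide_inverse algebra_simps del: flux.simps)
  have V: "2 * energy_t n \<gamma> S (t, s, u, p, q) = p\<^sup>2 + (real n + 1) * q * flux n \<gamma> S (t, s, u, p, q)"
    using potential_flux_star[OF assms *(2), of t s u p] by (simp add: energy_eq del: flux.simps potential.simps)
  have M: "u * a + u * dflux s u q (0, 1, q, b, c) = real n * q * flux n \<gamma> S (t, s, u, p, q)"
    using *(2,3) by (cases "u = 0") (auto simp: *(4) dflux_def flux_W field_simps simp del: flux.simps)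
  show "- t\<^sup>2 * (p * fst (snd (snd (snd (1::real, 0::real, p, a, b)))) + dpotential s u q (1, 0, p, a, b))
       + - 2 * t * fst (1::real, 0::real, p, a, b) * energy_t n \<gamma> S (t, s, u, p, q)
       + (t * (u * fst (snd (snd (snd (1::real, 0::real, p, a, b)))) + fst (snd (snd (1::real, 0::real, p, a, b))) * p)
         + fst (1::real, 0::real, p, a, b) * (u * p)) - u * fst (snd (snd (1::real, 0::real, p, a, b)))
      + (- t\<^sup>2 * (p * dflux s u q (0, 1, q, b, c) + fst (snd (snd (snd (0::real, 1::real, q, b, c)))) * flux n \<gamma> S (t, s, u, p, q))
       + - 2 * t * fst (0::real, 1::real, q, b, c) * energy_s n \<gamma> S (t, s, u, p, q)
       + (t * (u * dflux s u q (0, 1, q, b, c) + fst (snd (snd (0::real, 1::real, q, b, c))) * flux n \<gamma> S (t, s, u, p, q))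
         + fst (0::real, 1::real, q, b, c) * (u * flux n \<gamma> S (t, s, u, p, q)))) = 0"
    using E V M by (simp del: energy_t.simps energy_s.simps flux.simps) algebra
qed

end

section \<open>Point symmetries for arbitrary \<open>S\<close>\<close>

text \<open>The weight of t under \<open>X_scale\<close> when u has weight 2; it is the number k of
  the overview. The projective field scales t locally at twice the rate of u, which matches
  \<open>X_scale\<close> exactly when this weight is 4.\<close>

definition time_weight :: "nat \<Rightarrow> real \<Rightarrow> real" where "time_weight n \<gamma> = (real n + 1) * \<gamma> - real n + 1"

text \<open>The indices \<open>0, \<dots>, 4\<close> belong to \<open>X_time\<close>, \<open>X_scale\<close>, \<open>X_shift\<close>, \<open>X_galilei\<close> and \<open>X_proj\<close>.\<close>

definition sym_field :: "nat \<Rightarrow> real \<Rightarrow> (nat \<Rightarrow> real) \<Rightarrow> vfield" where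
  "sym_field n \<gamma> c = (\<lambda>(t, s, u). (c 0 + c 1 * time_weight n \<gamma> * t + c 4 * t\<^sup>2, 0, 2 * c 1 * u + c 2 + c 3 * t + c 4 * t * u))"

section \<open>Integration of gradients, and independence and derivatives of the candidate
  fields\<close>

lemma dird_zero:
  assumes "open D" "z \<in> D" "\<And>z. z \<in> D \<Longrightarrow> f z = 0"
  shows "dird f v z = 0"
  using dird_cong[OF assms(1,2), of "\<lambda>_. 0" f v] assms(3) by (simp add: dird_def)

text \<open>The integration step of the classification: with an explicit polynomial for g it
  determines an unknown function up to one constant.\<close>

lemma diff_constant_if_gradient_eq:
  fixes f :: "jet0 \<Rightarrow> real"
  assumes "open D" "connected D"
    and f: "\<And>z. z \<in> D \<Longrightarrow> f differentiable (at z)" and g: "\<And>z. (g has_derivative g' z) (at z)"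
    and eq: "\<And>z. z \<in> D \<Longrightarrow> dt f z = g' z (1, 0, 0)" "\<And>z. z \<in> D \<Longrightarrow> ds f z = g' z (0, 1, 0)"
      "\<And>z. z \<in> D \<Longrightarrow> du f z = g' z (0, 0, 1)"
  shows "\<exists>c. \<forall>z\<in>D. f z - g z = c"
proof -
  have "((\<lambda>z. f z - g z) has_derivative (\<lambda>v. 0)) (at z)" if z: "z \<in> D" for z
  proof -
    have g': "dird g v z = g' z v" for v using dird_eqI[OF g] .
    have gd: "g differentiable (at z)" using g unfolding differentiable_def by blast
    have "dird f v z - g' z v = 0" for v
    proof -
      obtain x y w where v: "v = (x, y, w)" by (cases v)
      show ?thesis
        using dird_coords[OF f[OF z], of x y w] dird_coords[OF gd, of x y w] unfolding g' v
        by (simp add: eq[OF z])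
    qed
    then show ?thesis using has_derivative_diff[OF dird_works[OF f[OF z]] g] by simp
  qed
  from has_derivative_zero_unique_connected[OF assms(1,2) this] show ?thesis
    by metis
qed

lemma open_jet0_box:
  assumes "open D" "(t, s, u) \<in> D"
  obtains e :: real where "e > 0" "\<And>t' s' u'. \<lbrakk>\<bar>t' - t\<bar> \<le> e; \<bar>s' - s\<bar> \<le> e; \<bar>u' - u\<bar> \<le> e\<rbrakk> \<Longrightarrow> (t', s', u') \<in> D"
proof -
  obtain A B where AB: "open A" "open B" "(t, s, u) \<in> A \<times> B" "A \<times> B \<subseteq> D"
    using open_prod_elim[OF assms] by metis
  obtain B1 B2 where B: "open B1" "open B2" "(s, u) \<in> B1 \<times> B2" "B1 \<times> B2 \<subseteq> B"
    using open_prod_elim[OF AB(2), of "(s, u)"] AB(3) by (metis mem_Sigma_iff)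
  obtain e1 where e1: "e1 > 0" "cball t e1 \<subseteq> A" using AB open_contains_cball by (metis mem_Sigma_iff)
  obtain e2 where e2: "e2 > 0" "cball s e2 \<subseteq> B1" using B open_contains_cball by (metis mem_Sigma_iff)
  obtain e3 where e3: "e3 > 0" "cball u e3 \<subseteq> B2" using B open_contains_cball by (metis mem_Sigma_iff)
  show ?thesis
  proof (rule that[of "min e1 (min e2 e3)"])
    show "min e1 (min e2 e3) > 0" using e1 e2 e3 by simp
    fix t' s' u' assume "\<bar>t' - t\<bar> \<le> min e1 (min e2 e3)" "\<bar>s' - s\<bar> \<le> min e1 (min e2 e3)" "\<bar>u' - u\<bar> \<le> min e1 (min e2 e3)"
    then have "t' \<in> cball t e1" "s' \<in> cball s e2" "u' \<in> cball u e3"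
      by (auto simp: dist_real_def abs_minus_commute)
    then show "(t', s', u') \<in> D" using e1 e2 e3 AB(4) B(4) by blast
  qed
qed

lemma time_weight_pos: "\<gamma> > 1 \<Longrightarrow> time_weight n \<gamma> > 0"
proof -
  assume "\<gamma> > 1"
  then have "0 \<le> real n * (\<gamma> - 1)" by simp
  then show ?thesis using \<open>\<gamma> > 1\<close> by (simp add: time_weight_def algebra_simps)
qed

lemma time_weight_star: "time_weight n \<gamma> = 4 \<longleftrightarrow> \<gamma> = gamma_star n"
  by (auto simp: time_weight_def gamma_star_def field_simps)

text \<open>Linear independence of the five fields on any nonempty open set. At fixed s and u the
  components are polynomials of degree at most 2 in t, so three equidistant times suffice;
  \<open>c 1\<close> is recovered because the time weight is nonzero.\<close>

lemma gen_eq_0: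
  assumes "open D" "D \<noteq> {}" "\<gamma> > 1" "\<And>z. z \<in> D \<Longrightarrow> sym_field n \<gamma> c z = 0"
  shows "c 0 = 0" "c 1 = 0" "c 2 = 0" "c 3 = 0" "c 4 = 0"
proof -
  obtain t s u where z: "(t, s, u) \<in> D" using assms(2) by auto
  obtain e where e: "e > 0" "\<And>t' s' u'. \<lbrakk>\<bar>t' - t\<bar> \<le> e; \<bar>s' - s\<bar> \<le> e; \<bar>u' - u\<bar> \<le> e\<rbrakk> \<Longrightarrow> (t', s', u') \<in> D"
    using open_jet0_box[OF assms(1) z] by metis
  define k where "k = time_weight n \<gamma>"
  have k: "k > 0" using time_weight_pos[OF assms(3)] by (simp add: k_def)
  have eq: "c 0 + c 1 * k * x + c 4 * x\<^sup>2 = 0" "2 * c 1 * u + c 2 + c 3 * x + c 4 * x * u = 0"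
    if "x = t \<or> x = t + e \<or> x = t - e" for x
    using assms(4)[OF e(2)[of x s u]] that e(1) by (auto simp: sym_field_def k_def zero_prod_def)
  note a = eq(1)[of t] eq(1)[of "t + e"] eq(1)[of "t - e"]
  have "c 4 * e\<^sup>2 = 0" using a by (simp add: power2_eq_square algebra_simps)
  then show c4: "c 4 = 0" using e by simp
  have "c 1 * k * e = 0" using a c4 by (simp add: algebra_simps)
  then show c1: "c 1 = 0" using e k by simp
  show "c 0 = 0" using a c4 c1 by simp
  have "c 2 + c 3 * t = 0" "c 2 + c 3 * (t + e) = 0" using eq(2)[of t] eq(2)[of "t + e"] c4 c1 by simp_all
  then have "c 3 * e = 0" by algebra
  then show c3: "c 3 = 0" using e by simp
  show "c 2 = 0" using eq(2)[of t] c4 c1 c3 by simp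
qed

text \<open>As in \<open>basis_on\<close>, the field agrees with \<open>sym_field\<close> on
  \<open>D\<close> alone; openness of \<open>D\<close> carries the agreement over to
  derivatives.\<close>

lemma gen_derivs:
  assumes "open D" and X: "\<forall>z\<in>D. X z = sym_field n \<gamma> c z"
  defines "k \<equiv> time_weight n \<gamma>"
  shows "Ck_on 2 D X"
    and "(t, s, u) \<in> D \<Longrightarrow> dird (xi_t X) v (t, s, u) = fst v * (c 1 * k + 2 * c 4 * t)"
    and "(t, s, u) \<in> D \<Longrightarrow> dird (xi_s X) v (t, s, u) = 0"
    and "(t, s, u) \<in> D \<Longrightarrow> dird (eta X) v (t, s, u) = fst v * (c 3 + c 4 * u) + snd (snd v) * (2 * c 1 + c 4 * t)"
    and "(t, s, u) \<in> D \<Longrightarrow> dird (dird (xi_t X) v) w (t, s, u) = fst v * (2 * c 4 * fst w)"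
    and "(t, s, u) \<in> D \<Longrightarrow> dird (dird (xi_s X) v) w (t, s, u) = 0"
    and "(t, s, u) \<in> D \<Longrightarrow> dird (dird (eta X) v) w (t, s, u) = fst v * (c 4 * snd (snd w)) + snd (snd v) * (c 4 * fst w)"
proof -
  let ?d = "\<lambda>z v. (fst v * (c 1 * k + 2 * c 4 * fst z), 0::real,
      fst v * (c 3 + c 4 * snd (snd z)) + snd (snd v) * (2 * c 1 + c 4 * fst z))"
  let ?dd = "\<lambda>v w. (fst v * (2 * c 4 * fst w), 0::real,
      fst v * (c 4 * snd (snd w)) + snd (snd v) * (c 4 * fst w))"
  have g: "sym_field n \<gamma> c = (\<lambda>z. (c 0 + c 1 * k * fst z + c 4 * (fst z)\<^sup>2, 0,
      2 * c 1 * snd (snd z) + c 2 + c 3 * fst z + c 4 * fst z * snd (snd z)))"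
    by (auto simp: sym_field_def k_def)
  have d1: "(sym_field n \<gamma> c has_derivative ?d z) (at z)" for z
    unfolding g by (auto intro!: derivative_eq_intros simp: fun_eq_iff algebra_simps)
  have d2: "((\<lambda>z. ?d z v) has_derivative ?dd v) (at z)" for v z
    by (auto intro!: derivative_eq_intros simp: fun_eq_iff algebra_simps)
  have "Ck_on 2 D (sym_field n \<gamma> c)"
    unfolding numeral_2_eq_2
    by (rule Ck_on_SucI[OF assms(1) d1], rule Ck_on_SucI[OF assms(1) d2]) simp
  then show C2: "Ck_on 2 D X" by (rule Ck_on_cong[OF assms(1)]) (simp add: X)
  have dX: "(X has_derivative ?d z) (at z)" if "z \<in> D" for z
    by (rule has_derivative_transform_within_open[OF d1 assms(1) that]) (simp add: X)
  have c1: "dird (xi_t X) v z = fst (?d z v)" "dird (xi_s X) v z = 0" "dird (eta X) v z = snd (snd (?d z v))"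
    if "z \<in> D" for z v
    unfolding xi_t_def[abs_def] xi_s_def[abs_def] eta_def[abs_def]
    using that by (auto intro!: dird_eqI derivative_eq_intros dX)
  have s: "(dird (xi_t X) v has_derivative (\<lambda>w. fst (?dd v w))) (at z)"
    "(dird (xi_s X) v has_derivative (\<lambda>w. 0)) (at z)"
    "(dird (eta X) v has_derivative (\<lambda>w. snd (snd (?dd v w)))) (at z)"
    if "z \<in> D" for z v
  proof -
    show "(dird (xi_t X) v has_derivative (\<lambda>w. fst (?dd v w))) (at z)"
      by (rule has_derivative_transform_within_open[OF has_derivative_fst[OF d2[of v z]] assms(1) that]) (simp add: c1)
    show "(dird (xi_s X) v has_derivative (\<lambda>w. 0)) (at z)"
      by (rule has_derivative_transform_within_open[OF has_derivative_const assms(1) that]) (simp add: c1)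
    show "(dird (eta X) v has_derivative (\<lambda>w. snd (snd (?dd v w)))) (at z)"
      by (rule has_derivative_transform_within_open[OF has_derivative_snd[OF has_derivative_snd[OF d2[of v z]]] assms(1) that])
        (simp add: c1)
  qed
  assume z: "(t, s, u) \<in> D"
  show "dird (xi_t X) v (t, s, u) = fst v * (c 1 * k + 2 * c 4 * t)" "dird (xi_s X) v (t, s, u) = 0"
    "dird (eta X) v (t, s, u) = fst v * (c 3 + c 4 * u) + snd (snd v) * (2 * c 1 + c 4 * t)"
    using c1[OF z] by auto
  show "dird (dird (xi_t X) v) w (t, s, u) = fst v * (2 * c 4 * fst w)"
    "dird (dird (xi_s X) v) w (t, s, u) = 0"
    "dird (dird (eta X) v) w (t, s, u) = fst v * (c 4 * snd (snd w)) + snd (snd v) * (c 4 * fst w)"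
    using s[OF z, THEN dird_eqI] by auto
qed

text \<open>A second-order Taylor polynomial realises any prescribed values of S and its first two
  derivatives at s.\<close>

lemma Ck_on_2_quadratic:
  fixes A B C s :: real
  assumes S_def: "S = (\<lambda>x. A + B * (x - s) + C * (x - s)\<^sup>2 / 2)"
  shows "Ck_on 2 UNIV S" "S s = A" "deriv S s = B" "deriv (deriv S) s = C"
proof -
  have 1: "(S has_real_derivative B + C * (x - s)) (at x)" for x
    unfolding S_def by (auto intro!: derivative_eq_intros)
  have 2: "((\<lambda>x. B + C * (x - s)) has_real_derivative C) (at x)" for x
    by (auto intro!: derivative_eq_intros)
  have 3: "deriv S = (\<lambda>x. B + C * (x - s))" using 1 DERIV_imp_deriv by blast
  show "S s = A" "deriv S s = B" by (simp_all add: 3) (simp add: S_def)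
  show "deriv (deriv S) s = C" unfolding 3 by (rule DERIV_imp_deriv[OF 2])
  show "Ck_on 2 UNIV S" unfolding numeral_2_eq_2
  proof (rule Ck_on_SucI[OF open_UNIV 1[unfolded has_field_derivative_def]])
    fix v
    have "((\<lambda>z. (B + C * (z - s)) * v) has_derivative (\<lambda>w. C * w * v)) (at z)" for z
      by (auto intro!: derivative_eq_intros)
    then show "Ck_on (Suc 0) UNIV (\<lambda>z. (B + C * (z - s)) * v)"
      by (rule Ck_on_SucI[OF open_UNIV]) simp
  qed
qed

section \<open>Determining equations for the point symmetries\<close>

context gas_equation
begin

lemma W_pos: "(t, s, u) \<in> D \<Longrightarrow> q > 0 \<Longrightarrow> W u q > 0"
  using phipow_pos upos' by (simp add: W_def)

text \<open>\<open>A\<close>, \<open>B\<close> and \<open>C\<close> are the values of \<open>S\<close>, \<open>S'\<close> and \<open>S''\<close>, which are arbitrary at a given point.\<close>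

definition sym_cond :: "vfield \<Rightarrow> real \<Rightarrow> real \<Rightarrow> real \<Rightarrow> real \<Rightarrow> real \<Rightarrow> real \<Rightarrow> real \<Rightarrow> real \<Rightarrow> real \<Rightarrow> real \<Rightarrow> bool" where
  "sym_cond X t s u p q b c A B C \<longleftrightarrow> (let
     R = B - real n * \<gamma> * A * (q / u) - \<gamma> * A * (c / q); a = - (W u q * R) in
     zeta_tt X (t, s, u, p, q, a, b, c) + W u q *
      (xi_s X (t, s, u) * (C - real n * \<gamma> * B * (q / u) - \<gamma> * B * (c / q))
        + eta X (t, s, u) * (real n * (1 - \<gamma>) / u * R + real n * \<gamma> * A * q / u\<^sup>2)
        + zeta_s X (t, s, u, p, q) * (- \<gamma> / q * R - real n * \<gamma> * A / u + \<gamma> * A * c / q\<^sup>2)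
        - zeta_ss X (t, s, u, p, q, a, b, c) * (\<gamma> * A / q)) = 0)"

lemma prolong2_gas:
  assumes "(t, s, u) \<in> D" "q > 0" "Ck_on 2 UNIV T"
    and "gas n \<gamma> T (t, s, u, p, q, a, b, c) = 0"
  shows "prolong2 X (gas n \<gamma> T) (t, s, u, p, q, a, b, c) = 0 \<longleftrightarrow>
    sym_cond X t s u p q b c (T s) (deriv T s) (deriv (deriv T) s)"
proof -
  have a: "a = - (W u q * (deriv T s - real n * \<gamma> * T s * (q / u) - \<gamma> * T s * (c / q)))"
    using assms(4) by (simp add: W_def)
  note d = frechet_derivative_at[OF gas_has_derivative[OF upos'[OF assms(1)] assms(2) Ck_on_2_real[OF assms(3)],
        where p = p and a = a and b = b and c = c]]
  show ?thesis
    unfolding prolong2_def d[symmetric] sym_cond_def Let_def a[symmetric]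
    by (simp del: zeta_tt.simps zeta_ss.simps zeta_s.simps zeta_t.simps zeta_ts.simps add: W_def)
qed

text \<open>The condition at a jet sees S only through three numbers. Every S supplies such a
  triple, and conversely a quadratic polynomial supplies every triple, so the quantifier over
  functions becomes one over reals.\<close>

lemma arbitrary_S_symmetry_iff:
  "arbitrary_S_symmetry D n \<gamma> X \<longleftrightarrow> Ck_on 2 D X \<and>
    (\<forall>t s u p q b c A B C. (t, s, u) \<in> D \<longrightarrow> q > 0 \<longrightarrow> sym_cond X t s u p q b c A B C)"
proof
  assume L: "arbitrary_S_symmetry D n \<gamma> X"
  show "Ck_on 2 D X \<and>
    (\<forall>t s u p q b c A B C. (t, s, u) \<in> D \<longrightarrow> q > 0 \<longrightarrow> sym_cond X t s u p q b c A B C)"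
  proof (intro conjI allI impI)
    show "Ck_on 2 D X" using L S by (auto simp: arbitrary_S_symmetry_def point_symmetry_def)
    fix t s u p q b c A B C assume *: "(t, s, u) \<in> D" "q > (0::real)"
    define T where "T = (\<lambda>x. A + B * (x - s) + C * (x - s)\<^sup>2 / 2)"
    note T = Ck_on_2_quadratic[OF T_def]
    \<comment> \<open>This choice of a places the jet on the equation for \<open>T\<close>.\<close>
    define a where "a = - (W u q * (B - real n * \<gamma> * A * (q / u) - \<gamma> * A * (c / q)))"
    have "gas n \<gamma> T (t, s, u, p, q, a, b, c) = 0" by (simp add: a_def T W_def)
    moreover from this have "prolong2 X (gas n \<gamma> T) (t, s, u, p, q, a, b, c) = 0"
      using L * T(1) unfolding arbitrary_S_symmetry_def point_symmetry_def by (metis mem_jets2)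
    ultimately show "sym_cond X t s u p q b c A B C"
      using prolong2_gas[OF * T(1)] T by metis
  qed
next
  assume R: "Ck_on 2 D X \<and>
    (\<forall>t s u p q b c A B C. (t, s, u) \<in> D \<longrightarrow> q > 0 \<longrightarrow> sym_cond X t s u p q b c A B C)"
  show "arbitrary_S_symmetry D n \<gamma> X"
    unfolding arbitrary_S_symmetry_def point_symmetry_def
  proof (intro allI impI conjI ballI)
    show "Ck_on 2 D X" using R by simp
    fix T j assume T: "Ck_on 2 UNIV T" and j: "j \<in> jets2 D" "gas n \<gamma> T j = 0"
    obtain t s u p q a b c where jj: "j = (t, s, u, p, q, a, b, c)"
      by (cases j; cases "snd (snd (snd (snd (snd (snd j)))))") auto
    show "prolong2 X (gas n \<gamma> T) j = 0"
      unfolding jj using prolong2_gas[OF _ _ T] R j by (metis jj mem_jets2)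
  qed
qed

lemma determining_equations:
  assumes X: "arbitrary_S_symmetry D n \<gamma> X" and z: "z \<in> D"
  shows "xi_s X z = 0" "ds (eta X) z = 0" "ds (xi_t X) z = 0" "du (xi_t X) z = 0"
    "dt (dt (eta X)) z = 0" "2 * dt (du (eta X)) z = dt (dt (xi_t X)) z" "du (du (eta X)) z = 0"
    "time_weight n \<gamma> * du (eta X) z = 2 * dt (xi_t X) z"
    "n \<noteq> 0 \<Longrightarrow> eta X z = snd (snd z) * du (eta X) z"
proof -
  have C2: "Ck_on 2 D X" and C: "\<And>t s u p q b c A B C. (t, s, u) \<in> D \<Longrightarrow> q > 0 \<Longrightarrow> sym_cond X t s u p q b c A B C"
    using X by (auto simp: arbitrary_S_symmetry_iff)
  note comp = Ck_on_components[OF D C2]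
  note zt = zeta_tt_eq[OF D C2] and zs = zeta_s_eq[OF D C2] and zss = zeta_ss_eq[OF D C2]
  \<comment> \<open>With all three values of S zero the equation is a = 0. The remaining tests use
    one nonzero value each: C = 1 in \<open>sig\<close>, B = 1 in \<open>bracket\<close>, A = 1 in
    the last claim.\<close>
  have free: "zeta_tt X (t, s, u, p, q, 0, b, c) = 0" if "(t, s, u) \<in> D" "q > 0" for t s u p q b c
    using C[OF that, of p b c 0 0 0] by (simp add: sym_cond_def del: zeta_tt.simps zeta_ss.simps zeta_s.simps)
  have sig: "xi_s X z = 0" if "z \<in> D" for z
  proof -
    obtain t s u where zz: "z = (t, s, u)" by (cases z)
    have "W u 1 * xi_s X (t, s, u) = 0"
      using C[OF that[unfolded zz], of 1 0 0 0 0 0 1] free[OF that[unfolded zz], of 1 0 0 0]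
      by (simp add: sym_cond_def del: zeta_tt.simps zeta_ss.simps zeta_s.simps)
    then show ?thesis using W_pos[OF that[unfolded zz], of 1] by (simp add: zz)
  qed
  have sig1: "dird (xi_s X) v z = 0" if "z \<in> D" for z v
    using dird_zero[OF D that sig] .
  have sig2: "dird (dird (xi_s X) v) w z = 0" if "z \<in> D" for z v w
    using dird_zero[OF D that sig1] .
  \<comment> \<open>With B = 1 and c = 0 the equation gives a = -W. \<open>zeta_tt\<close> is affine
    in a, and \<open>free\<close> removes the part independent of a, so every remaining term carries
    the factor W, which is positive.\<close>
  have bracket: "- (du (eta X) z) + 2 * dt (xi_t X) z + 3 * p * du (xi_t X) z
      + real n * (1 - \<gamma>) / u * eta X z
      - \<gamma> / q * (ds (eta X) z + q * du (eta X) z - p * (ds (xi_t X) z + q * du (xi_t X) z)) = 0"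
    if "z = (t, s, u)" "z \<in> D" "q > 0" for z t s u p q
  proof -
    have z: "(t, s, u) \<in> D" using that by simp
    have ztt: "zeta_tt X (t, s, u, p, q, - W u q, 0, 0)
        = - W u q * (du (eta X) z - 2 * dt (xi_t X) z - 3 * p * du (xi_t X) z)"
      using free[OF z that(3), of p 0 0] sig1[OF z] sig2[OF z]
      unfolding zt[OF z that(3)] Let_def Dtt_def that(1) by (simp add: algebra_simps)
    have zss': "zeta_s X (t, s, u, p, q)
        = ds (eta X) z + q * du (eta X) z - p * (ds (xi_t X) z + q * du (xi_t X) z)"
      unfolding zs[OF z] Let_def that(1) using sig1[OF z] by simp
    have "zeta_tt X (t, s, u, p, q, - W u q, 0, 0)
        + W u q * (eta X z * (real n * (1 - \<gamma>) / u) + zeta_s X (t, s, u, p, q) * (- \<gamma> / q)) = 0"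
      using C[OF z that(3), of p 0 0 0 1 0] sig[OF z] that(1)
      by (simp add: sym_cond_def Let_def del: zeta_tt.simps zeta_ss.simps zeta_s.simps)
    then have "W u q * (- (du (eta X) z) + 2 * dt (xi_t X) z + 3 * p * du (xi_t X) z
      + real n * (1 - \<gamma>) / u * eta X z
      - \<gamma> / q * (ds (eta X) z + q * du (eta X) z - p * (ds (xi_t X) z + q * du (xi_t X) z))) = 0"
      unfolding ztt zss' minus_divide_left[symmetric] by (simp only: divide_inverse) algebra
    then show ?thesis using W_pos[of t s u q] that by simp
  qed
  have first: "ds (eta X) z = 0 \<and> ds (xi_t X) z = 0 \<and> du (xi_t X) z = 0 \<and>
      (1 + \<gamma>) * du (eta X) z = 2 * dt (xi_t X) z + real n * (1 - \<gamma>) / snd (snd z) * eta X z"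
    if "z \<in> D" for z
  proof -
    obtain t s u where zz: "z = (t, s, u)" by (cases z)
    define K where "K = real n * (1 - \<gamma>) / u * eta X z"
    have b: "q * (- (du (eta X) z) + 2 * dt (xi_t X) z + 3 * p * du (xi_t X) z + K)
      - \<gamma> * (ds (eta X) z + q * du (eta X) z - p * (ds (xi_t X) z + q * du (xi_t X) z)) = 0"
      if "q > 0" for p q
    proof -
      have "q * (- (du (eta X) z) + 2 * dt (xi_t X) z + 3 * p * du (xi_t X) z + K
        - \<gamma> / q * (ds (eta X) z + q * du (eta X) z - p * (ds (xi_t X) z + q * du (xi_t X) z))) = 0"
        using bracket[OF zz \<open>z \<in> D\<close> that, of p] unfolding K_def by simp
      then show ?thesis using that by (simp add: right_diff_distrib)
    qed
    \<comment> \<open>After multiplication by q the bracket is affine in p and in q separately; its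
      four coefficients are recovered from p = 0, 1 and q = 1, 2.\<close>
    note b = b[of 1 0, simplified] b[of 2 0, simplified] b[of 1 1, simplified] b[of 2 1, simplified]
    have "\<gamma> * ds (eta X) z = 0" using b(1,2) by algebra
    then have 1: "ds (eta X) z = 0" using \<gamma> by simp
    have "\<gamma> * ds (xi_t X) z = 0" using b by algebra
    then have 2: "ds (xi_t X) z = 0" using \<gamma> by simp
    have "(3 + \<gamma>) * du (xi_t X) z = 0" using b(1,3) 2 by algebra
    then have 3: "du (xi_t X) z = 0" using \<gamma> by simp
    have "(1 + \<gamma>) * du (eta X) z = 2 * dt (xi_t X) z + K"
      using b(1) 1 by algebra
    with 1 2 3 show ?thesis by (simp add: K_def zz)
  qed
  show "xi_s X z = 0" "ds (eta X) z = 0" "ds (xi_t X) z = 0" "du (xi_t X) z = 0"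
    using sig first z by auto
  \<comment> \<open>The relations in \<open>first\<close> hold on all of the open set
    \<open>D\<close> and may therefore be differentiated once.\<close>
  have tu: "dird (du (xi_t X)) v z = 0" "dird (ds (eta X)) v z = 0" for v
    by (rule dird_zero[OF D z], use first in auto)+
  have su: "ds (du (eta X)) z = 0" using tu(2) dird_commute[OF D comp(3) z] by metis
  obtain t s u where zz: "z = (t, s, u)" by (cases z)
  \<comment> \<open>What is left of \<open>free\<close> is quadratic in p; the values p = 0, 1, -1
    separate its coefficients.\<close>
  have pol: "dt (dt (eta X)) z + 2 * p * dt (du (eta X)) z + p\<^sup>2 * du (du (eta X)) z = p * dt (dt (xi_t X)) z" for p
    using free[of t s u 1 p 0 0] z sig1[OF z] sig2[OF z] tu(1)
    by (simp add: Let_def zt Dtt_def zz del: zeta_tt.simps)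
  show "dt (dt (eta X)) z = 0" "2 * dt (du (eta X)) z = dt (dt (xi_t X)) z" and uu: "du (du (eta X)) z = 0"
    using pol[of 0] pol[of 1] pol[of "-1"] by auto
  note e1 = first[OF z]
  show 9: "eta X z = snd (snd z) * du (eta X) z" if n: "n \<noteq> 0"
  proof -
    have u: "u > 0" using upos'[of t s u] n z zz by simp
    have zD: "(t, s, u) \<in> D" using z zz by simp
    \<comment> \<open>The value of a on the equation for A = 1, B = C = 0 at p = 0, q = 1, c =
      0.\<close>
    define a where "a = W u 1 * (real n * \<gamma> / u)"
    have ztt: "zeta_tt X (t, s, u, 0, 1, a, 0, 0) = a * (du (eta X) z - 2 * dt (xi_t X) z)"
      using free[OF zD, of 1 0 0 0] sig1[OF zD] sig2[OF zD]
      unfolding zt[OF zD zero_less_one] Let_def Dtt_def zz by (simp add: algebra_simps)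
    have zs': "zeta_s X (t, s, u, 0, 1) = du (eta X) z"
      unfolding zs[OF zD] Let_def using sig1[OF zD] e1 zz by simp
    have zss': "zeta_ss X (t, s, u, 0, 1, a, 0, 0) = 0"
      unfolding zss[OF zD zero_less_one] Let_def Dss_def using sig1[OF zD] sig2[OF zD] su uu tu(2) zz by simp
    have "zeta_tt X (t, s, u, 0, 1, a, 0, 0) + W u 1 *
        (eta X z * (real n * (1 - \<gamma>) / u * - (real n * \<gamma> / u) + real n * \<gamma> / u\<^sup>2)
         + zeta_s X (t, s, u, 0, 1) * (\<gamma> * (real n * \<gamma> / u) - real n * \<gamma> / u)) = 0"
      using C[OF zD zero_less_one, of 0 0 0 1 0 0] sig[OF zD] zss' zz
      by (simp add: sym_cond_def Let_def a_def del: zeta_tt.simps zeta_ss.simps zeta_s.simps)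
    then have "a * (\<gamma> * du (eta X) z - 2 * dt (xi_t X) z
        - real n * (1 - \<gamma>) * (eta X z / u) + eta X z / u) = 0"
      unfolding ztt zs' unfolding a_def by (simp only: divide_inverse power2_eq_square inverse_mult_distrib) algebra
    moreover have "a \<noteq> 0" using W_pos[OF zD, of 1] n \<gamma> u by (simp add: a_def)
    ultimately have "\<gamma> * du (eta X) z - 2 * dt (xi_t X) z
        - real n * (1 - \<gamma>) * (eta X z / u) + eta X z / u = 0" by simp
    \<comment> \<open>Comparison with the last relation of \<open>first\<close>: both express the
      same combination of the other terms, once through \<open>eta X z / u\<close> and once through
      \<open>du (eta X) z\<close>.\<close>
    then have "eta X z / u = du (eta X) z" using e1 zz by (simp add: algebra_simps)
    then show ?thesis using u zz by (simp add: field_simps)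
  qed
  show "time_weight n \<gamma> * du (eta X) z = 2 * dt (xi_t X) z"
  proof (cases "n = 0")
    case True
    then show ?thesis using e1 by (simp add: time_weight_def algebra_simps)
  next
    case False
    then have "u > 0" using upos'[of t s u] z zz by simp
    then have "real n * (1 - \<gamma>) / snd (snd z) * eta X z = real n * (1 - \<gamma>) * du (eta X) z"
      using 9[OF False] zz by simp
    then show ?thesis using e1 by (simp add: time_weight_def algebra_simps)
  qed
qed

definition admissible :: "(nat \<Rightarrow> real) \<Rightarrow> bool" where
  "admissible c \<longleftrightarrow> (n \<noteq> 0 \<longrightarrow> c 2 = 0 \<and> c 3 = 0) \<and> (\<gamma> \<noteq> gamma_star n \<longrightarrow> c 4 = 0)"

text \<open>With f the u-derivative of \<open>eta X\<close>, the field acts like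
  \<open>X_scale\<close> with local rate f: \<open>zeta_s\<close> is q f, \<open>zeta_ss\<close> is
  c' f and \<open>zeta_tt\<close> is a f (1 - k). The condition then reduces to the balance of
  weights k = 1 + \<gamma> - n (1 - \<gamma>), which is the definition of
  \<open>time_weight\<close>.\<close>

lemma gen_is_symmetry:
  assumes "admissible c" and X: "\<forall>z\<in>D. X z = sym_field n \<gamma> c z"
  shows "arbitrary_S_symmetry D n \<gamma> X"
  unfolding arbitrary_S_symmetry_iff
proof (intro conjI allI impI)
  note d = gen_derivs[OF D X]
  show C2: "Ck_on 2 D X" by (rule d(1))
  fix t s u p q b c' A B C assume z: "(t, s, u) \<in> D" and q: "q > (0::real)"
  define f where "f = 2 * c 1 + c 4 * t"
  define R where "R = B - real n * \<gamma> * A * (q / u) - \<gamma> * A * (c' / q)"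
  have k4: "(time_weight n \<gamma> - 4) * c 4 = 0" using assms(1) time_weight_star by (auto simp: admissible_def)
  \<comment> \<open>The relation 2 \<open>dt (xi_t X)\<close> = k f. Its term with
    \<open>c 4\<close> balances because \<open>c 4\<close> vanishes unless k = 4.\<close>
  then have k: "2 * (c 1 * time_weight n \<gamma> + 2 * c 4 * t) = time_weight n \<gamma> * f"
    unfolding f_def by algebra
  have v: "xi_s X (t, s, u) = 0" "real n * eta X (t, s, u) = real n * u * f"
    using bspec[OF X z] assms(1) by (auto simp: xi_s_def eta_def sym_field_def admissible_def f_def algebra_simps)
  have zs: "zeta_s X (t, s, u, p, q) = q * f"
    unfolding zeta_s_eq[OF D C2 z] using d z by (simp add: f_def)
  have zss: "zeta_ss X (t, s, u, p, q, a, b, c') = c' * f" for a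
    unfolding zeta_ss_eq[OF D C2 z q] using d z by (simp add: f_def Dss_def)
  have ztt: "zeta_tt X (t, s, u, p, q, a, b, c') = a * f * (1 - time_weight n \<gamma>)" for a
  proof -
    have "zeta_tt X (t, s, u, p, q, a, b, c') = a * f - a * (2 * (c 1 * time_weight n \<gamma> + 2 * c 4 * t))"
      unfolding zeta_tt_eq[OF D C2 z q] f_def using d z by (simp add: Dtt_def algebra_simps)
    then show ?thesis unfolding k by (simp add: algebra_simps)
  qed
  have e: "eta X (t, s, u) * (real n * (1 - \<gamma>) / u * R + real n * \<gamma> * A * q / u\<^sup>2)
    = f * (real n * (1 - \<gamma>) * R + real n * \<gamma> * A * q / u)"
  proof (cases "n = 0")
    case False
    then have "u > 0" "eta X (t, s, u) = u * f" using v(2) upos'[OF z] by auto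
    then show ?thesis by (simp add: field_simps power2_eq_square)
  qed simp
  have s: "q * f * (- \<gamma> / q * R - real n * \<gamma> * A / u + \<gamma> * A * c' / q\<^sup>2) - c' * f * (\<gamma> * A / q)
     = f * (- \<gamma> * R - real n * \<gamma> * A * q / u)"
    using q by (simp add: divide_simps power2_eq_square) (simp add: algebra_simps)
  show "sym_cond X t s u p q b c' A B C"
    unfolding sym_cond_def Let_def R_def[symmetric] ztt zs zss v(1) e
    unfolding add_diff_eq[symmetric] s by (simp add: time_weight_def algebra_simps)
qed

end

section \<open>Integration of the determining equations\<close>

lemma Ck_on_const: "Ck_on k D (\<lambda>_. c)"
  by (induction k arbitrary: c) auto

text \<open>Third derivatives of \<open>f\<close> are not available.  Instead \<open>f\<^sub>t\<close> does not depend on \<open>t\<close>, so neither does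
  \<open>f\<^sub>t\<^sub>u\<close>, and \<open>f\<^sub>u\<close> does not depend on \<open>s\<close> and \<open>u\<close>, so neither does \<open>f\<^sub>u\<^sub>t\<close>.\<close>

lemma dt_du_constant:
  fixes f :: "jet0 \<Rightarrow> real"
  assumes D: "open D" "connected D" and f: "Ck_on 2 D f"
    and 0: "\<And>z. z \<in> D \<Longrightarrow> ds f z = 0" "\<And>z. z \<in> D \<Longrightarrow> dt (dt f) z = 0" "\<And>z. z \<in> D \<Longrightarrow> du (du f) z = 0"
  shows "\<exists>c. \<forall>z\<in>D. dt (du f) z = c"
proof -
  note C = Ck_on_2D[OF f] and comm = dird_commute[OF D(1) f]
  have s: "ds (dt f) z = 0" "ds (du f) z = 0" if "z \<in> D" for z
    using comm[OF that, of "(0, 1, 0)"] dird_zero[OF D(1) that 0(1)] by simp_all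
  \<comment> \<open>In a ball any two points z and z' with z the center are joined by a path
    parallel to the axes; connectedness of \<open>D\<close> then globalises the result.\<close>
  have loc: "\<forall>\<^sub>F z' in at z within D. dt (du f) z = dt (du f) z'" if z: "z \<in> D" for z
  proof -
    obtain r where r: "r > 0" "ball z r \<subseteq> D" using D(1) z by (meson openE)
    define B where "B = ball z r"
    have B: "convex B" "open B" "B \<subseteq> D" by (auto simp: B_def r)
    have "dt (du f) z = dt (du f) z'" if "z' \<in> B" for z'
    proof -
      obtain t s u where zz: "z = (t, s, u)" by (cases z)
      obtain t' s' u' where zz': "z' = (t', s', u')" by (cases z')
      have d: "(t' - t)\<^sup>2 + ((s' - s)\<^sup>2 + (u' - u)\<^sup>2) < r\<^sup>2"
        using that r(1) real_sqrt_less_iff[of _ "r\<^sup>2"]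
        by (simp add: B_def zz zz' dist_norm norm_Pair norm_minus_commute power2_commute)
      \<comment> \<open>Each coordinate of a corner of the box spanned by z and z' differs from that
        of z by 0 or by the full difference, so no corner is farther from z than z' is.\<close>
      have sub: "(x, y, w) \<in> B" if "x \<in> {t, t'}" "y \<in> {s, s'}" "w \<in> {u, u'}" for x y w
      proof -
        have "(x - t)\<^sup>2 + ((y - s)\<^sup>2 + (w - u)\<^sup>2) \<le> (t' - t)\<^sup>2 + ((s' - s)\<^sup>2 + (u' - u)\<^sup>2)"
          using that by (intro add_mono) auto
        then have "sqrt ((x - t)\<^sup>2 + ((y - s)\<^sup>2 + (w - u)\<^sup>2)) < r"
          using d r(1) by (intro real_less_lsqrt) auto
        then show ?thesis by (simp add: B_def zz dist_norm norm_Pair power2_commute)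
      qed
      have subD: "(x, y, w) \<in> D" if "x \<in> {t, t'}" "y \<in> {s, s'}" "w \<in> {u, u'}" for x y w
        using sub[OF that] B(3) by blast
      have BD: "z \<in> D" if "z \<in> B" for z using that B(3) by blast
      have e1: "du (dt f) ((t, s, u) + (t' - t) *\<^sub>R (1, 0, 0)) = du (dt f) (t, s, u)"
        by (rule dird_eq_along_direction[OF B(1,2) C(2)[OF BD] 0(2)[OF BD]])
          (simp_all add: sub)
      have e2: "dt (du f) ((t', s, u) + (s' - s) *\<^sub>R (0, 1, 0)) = dt (du f) (t', s, u)"
        by (rule dird_eq_along_direction[OF B(1,2) C(2)[OF BD] s(2)[OF BD]])
          (simp_all add: sub)
      have e3: "dt (du f) ((t', s', u) + (u' - u) *\<^sub>R (0, 0, 1)) = dt (du f) (t', s', u)"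
        by (rule dird_eq_along_direction[OF B(1,2) C(2)[OF BD] 0(3)[OF BD]])
          (simp_all add: sub)
      have "dt (du f) (t, s, u) = du (dt f) (t, s, u)"
        by (rule comm) (simp add: subD)
      also have "\<dots> = du (dt f) (t', s, u)" using e1 by simp
      also have "\<dots> = dt (du f) (t', s, u)"
        by (rule comm) (simp add: subD)
      also have "\<dots> = dt (du f) (t', s', u)" using e2 by simp
      also have "\<dots> = dt (du f) (t', s', u')" using e3 by simp
      finally show ?thesis by (simp add: zz zz')
    qed
    then show ?thesis
      unfolding eventually_at_topological using B(2) r(1)
      by (intro exI[of _ B]) (auto simp: B_def)
  qed
  then have "dt (du f) z = dt (du f) z'" if "z \<in> D" "z' \<in> D" for z z'
    using connected_local_const[OF D(2) that] by blast
  then show ?thesis by metis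
qed

locale gas_domain = gas_equation +
  assumes connected: "connected D" and nonempty: "D \<noteq> {}"
begin

lemma symmetry_is_gen:
  assumes X: "arbitrary_S_symmetry D n \<gamma> X"
  shows "\<exists>c. admissible c \<and> (\<forall>z\<in>D. X z = sym_field n \<gamma> c z)"
proof -
  define k where "k = time_weight n \<gamma>"
  have kpos: "k > 0" using time_weight_pos[OF \<gamma>] by (simp add: k_def)
  have C2: "Ck_on 2 D X" using X by (simp add: arbitrary_S_symmetry_iff)
  define \<tau> \<eta> where "\<tau> = xi_t X" and "\<eta> = eta X"
  note cX = Ck_on_components[OF D C2, folded \<tau>_def \<eta>_def]
  note \<tau> = Ck_on_2D[OF cX(1)] and \<eta> = Ck_on_2D[OF cX(3)]
  note eqs = determining_equations[OF X, folded \<tau>_def \<eta>_def k_def]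
  note comm = dird_commute[OF D cX(3)] dird_commute[OF D cX(1)]
  obtain c4 where c4: "\<And>z. z \<in> D \<Longrightarrow> dt (du \<eta>) z = c4"
    using dt_du_constant[OF D connected cX(3) eqs(2,5,7)] by blast
  have s0: "ds (dt \<eta>) z = 0" "ds (du \<eta>) z = 0" if "z \<in> D" for z
    using comm(1)[OF that, of "(0, 1, 0)"] dird_zero[OF D that eqs(2)] by simp_all
  \<comment> \<open>Differentiate \<open>eqs(8)\<close> once in t, then replace the second
    t-derivative of \<tau> by twice the mixed derivative \<open>c4\<close>.\<close>
  have k4: "(k - 4) * c4 = 0"
  proof -
    obtain z where z: "z \<in> D" using nonempty by auto
    have "dt (du \<eta>) z = dt (\<lambda>z. 2 / k * dt \<tau> z) z"
      by (rule dird_cong[OF D z \<eta>(2)[OF z]]) (use eqs(8) kpos in \<open>simp add: field_simps\<close>)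
    also have "\<dots> = 2 / k * dt (dt \<tau>) z"
      by (rule dird_eqI) (intro has_derivative_mult_right dird_works \<tau> z)
    also have "\<dots> = 4 * c4 / k" using eqs(6)[OF z] c4[OF z] by simp
    finally show ?thesis using c4[OF z] kpos by (simp add: field_simps)
  qed
  have "\<exists>g0. \<forall>z\<in>D. du \<eta> z - c4 * fst z = g0"
  proof (rule diff_constant_if_gradient_eq[OF D connected \<eta>(2)])
    show "((\<lambda>z::jet0. c4 * fst z) has_derivative (\<lambda>v. c4 * fst v)) (at z)" for z
      by (auto intro!: derivative_eq_intros)
  qed (use c4 s0 eqs(7) in simp_all)
  then obtain g0 where "\<And>z. z \<in> D \<Longrightarrow> du \<eta> z - c4 * fst z = g0" by blast
  then have du\<eta>: "du \<eta> z = g0 + c4 * fst z" if "z \<in> D" for z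
    using that by (metis add.commute diff_add_cancel)
  have ut: "du (dt \<eta>) z = c4" if "z \<in> D" for z
    using comm(1)[OF that, of "(1, 0, 0)"] c4[OF that] by simp
  have "\<exists>c3. \<forall>z\<in>D. dt \<eta> z - c4 * snd (snd z) = c3"
  proof (rule diff_constant_if_gradient_eq[OF D connected \<eta>(2)])
    show "((\<lambda>z::jet0. c4 * snd (snd z)) has_derivative (\<lambda>v. c4 * snd (snd v))) (at z)" for z
      by (auto intro!: derivative_eq_intros)
  qed (use ut s0 eqs(5) in simp_all)
  then obtain c3 where "\<And>z. z \<in> D \<Longrightarrow> dt \<eta> z - c4 * snd (snd z) = c3" by blast
  then have dt\<eta>: "dt \<eta> z = c3 + c4 * snd (snd z)" if "z \<in> D" for z
    using that by (metis add.commute diff_add_cancel)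
  have dt\<tau>: "dt \<tau> z = g0 / 2 * k + 2 * c4 * fst z" if "z \<in> D" for z
  proof -
    have "k * (g0 + c4 * fst z) = 2 * dt \<tau> z" using eqs(8)[OF that] du\<eta>[OF that] by simp
    then have "2 * dt \<tau> z = g0 * k + 4 * c4 * fst z" using k4 by algebra
    then show ?thesis by simp
  qed
  have "\<exists>c0. \<forall>z\<in>D. \<tau> z - (g0 / 2 * k * fst z + c4 * (fst z)\<^sup>2) = c0"
  proof (rule diff_constant_if_gradient_eq[OF D connected \<tau>(1)])
    show "((\<lambda>z::jet0. g0 / 2 * k * fst z + c4 * (fst z)\<^sup>2) has_derivative
      (\<lambda>v. g0 / 2 * k * fst v + 2 * c4 * fst z * fst v)) (at z)" for z
      by (auto intro!: derivative_eq_intros)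
  qed (use dt\<tau> eqs(3,4) in simp_all)
  then obtain c0 where c0: "\<And>z. z \<in> D \<Longrightarrow> \<tau> z - (g0 / 2 * k * fst z + c4 * (fst z)\<^sup>2) = c0" by blast
  have "\<exists>c2. \<forall>z\<in>D. \<eta> z - (g0 * snd (snd z) + c3 * fst z + c4 * (fst z * snd (snd z))) = c2"
  proof (rule diff_constant_if_gradient_eq[OF D connected \<eta>(1)])
    show "((\<lambda>z::jet0. g0 * snd (snd z) + c3 * fst z + c4 * (fst z * snd (snd z))) has_derivative
      (\<lambda>v. g0 * snd (snd v) + c3 * fst v + c4 * (fst z * snd (snd v) + fst v * snd (snd z)))) (at z)" for z
      by (auto intro!: derivative_eq_intros)
  qed (use eqs(2) dt\<eta> du\<eta> in simp_all)
  then obtain c2 where c2: "\<And>z. z \<in> D \<Longrightarrow>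
      \<eta> z - (g0 * snd (snd z) + c3 * fst z + c4 * (fst z * snd (snd z))) = c2" by blast
  \<comment> \<open>\<open>g0\<close> is the time-independent part of \<open>du \<eta>\<close>.
    Since \<open>X_scale\<close> has component 2 u, it is twice the coefficient with index
    1.\<close>
  define c where "c = (\<lambda>i::nat. if i = 0 then c0 else if i = 1 then g0 / 2 else if i = 2 then c2
    else if i = 3 then c3 else c4)"
  have Xc: "X z = sym_field n \<gamma> c z" if "z \<in> D" for z
  proof -
    obtain t s u where zz: "z = (t, s, u)" by (cases z)
    have "X z = (\<tau> z, xi_s X z, \<eta> z)" by (simp add: \<tau>_def \<eta>_def xi_t_def xi_s_def eta_def)
    then show ?thesis
      using c0[OF that] c2[OF that] eqs(1)[OF that] by (auto simp: zz sym_field_def c_def k_def algebra_simps)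
  qed
  have "c2 = 0 \<and> c3 = 0" if "n \<noteq> 0"
  proof -
    \<comment> \<open>By \<open>eqs(9)\<close> the difference of \<eta> and u times its u-derivative
      vanishes, which leaves c2 + c3 t = 0. This is written as a vanishing \<open>sym_field\<close>
      so that linear independence applies.\<close>
    let ?c' = "\<lambda>i::nat. if i = 2 then c2 else if i = 3 then c3 else 0"
    have "sym_field n \<gamma> ?c' z = 0" if "z \<in> D" for z
      using eqs(9)[OF that \<open>n \<noteq> 0\<close>] c2[OF that] du\<eta>[OF that]
      by (cases z) (auto simp: sym_field_def zero_prod_def algebra_simps)
    from gen_eq_0(3,4)[OF D nonempty \<gamma> this] show ?thesis by simp
  qed
  moreover have "c4 = 0" if "\<gamma> \<noteq> gamma_star n" using k4 that time_weight_star by (simp add: k_def)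
  ultimately have "admissible c" by (simp add: admissible_def c_def)
  then show ?thesis using Xc by blast
qed

lemma arbitrary_S_symmetry_gen:
  "arbitrary_S_symmetry D n \<gamma> X \<longleftrightarrow> (\<exists>c. admissible c \<and> (\<forall>z\<in>D. X z = sym_field n \<gamma> c z))"
  using symmetry_is_gen gen_is_symmetry by blast

section \<open>Noether symmetries\<close>

text \<open>Apart from the terms with \<open>c 3\<close> and \<open>c 4 * u\<close>, the prolonged
  field multiplies both the kinetic and the potential part of \<open>L\<close> by (2 - k) f. The
  divergence of the field adds k f / 2, and in the sum (4 - k) f / 2 the contribution of
  \<open>c 4\<close> vanishes.\<close>

lemma noether_lhs_gen:
  fixes p :: real
  assumes c: "admissible c" and X: "\<forall>z\<in>D. X z = sym_field n \<gamma> c z" and z: "(t, s, u) \<in> D" and q: "q > 0"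
  defines "j \<equiv> (t, s, u, p, q)"
  shows "prolong1 X L j + L j * (Dt0 (xi_t X) j + Ds0 (xi_s X) j)
    = (4 - time_weight n \<gamma>) * c 1 * L j + c 3 * p + c 4 * (u * p)"
proof -
  note d = gen_derivs[OF D X]
  note comp = Ck_on_components[OF D d(1), THEN Ck_on_2D(1), OF z]
  have j: "(t, s, u, p, q) \<in> jets1 D" using z q by (simp add: mem_jets1)
  define f where "f = 2 * c 1 + c 4 * t"
  define k where "k = time_weight n \<gamma>"
  define V where "V = S s * W u q * q / (\<gamma> - 1)"
  have LV: "L j = p\<^sup>2 / 2 - V" unfolding L_eq j_def V_def potential_W[OF q] by simp
  have k4: "(k - 4) * c 4 = 0" using c time_weight_star by (auto simp: admissible_def k_def)
  have Dt\<tau>: "Dt0 (xi_t X) j = c 1 * k + 2 * c 4 * t" and Ds\<sigma>: "Ds0 (xi_s X) j = 0"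
    unfolding j_def using Dt0_eq[OF comp(1)] Ds0_eq[OF comp(2)] d z by (simp_all add: k_def)
  have zt: "zeta_t X (t, s, u, p, q) = c 3 + c 4 * u + p * (f - (c 1 * k + 2 * c 4 * t))"
    unfolding zeta_t_eq[OF D d(1) z] using d z by (simp add: f_def k_def algebra_simps)
  have zs: "zeta_s X (t, s, u, p, q) = q * f"
    unfolding zeta_s_eq[OF D d(1) z] using d z by (simp add: f_def)
  have v: "xi_s X (t, s, u) = 0" "real n * eta X (t, s, u) = real n * u * f"
    using bspec[OF X z] c by (auto simp: xi_s_def eta_def sym_field_def admissible_def f_def algebra_simps)
  have e: "eta X (t, s, u) * (real n * S s * q / u) = real n * S s * q * f"
  proof (cases "n = 0")
    case False
    then have "u > 0" "eta X (t, s, u) = u * f" using v(2) upos'[OF z] by auto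
    then show ?thesis by simp
  qed simp
  have V': "W u q * (real n * S s * q * f + q * f * S s) = (k - 2) * f * V"
    using \<gamma> by (simp add: V_def k_def time_weight_def field_simps)
  have "prolong1 X L j = p * zeta_t X j + (k - 2) * f * V"
    unfolding prolong1_def j_def frechet_derivative_at[OF L_has_derivative[OF j], symmetric]
    using v(1) e V' by (simp add: dpotential_def zs algebra_simps del: zeta_s.simps zeta_t.simps)
  then have P: "prolong1 X L j = p * (c 3 + c 4 * u + p * (f - (c 1 * k + 2 * c 4 * t))) + (k - 2) * f * V"
    unfolding j_def zt .
  define h where "h = p\<^sup>2 / 2"
  have h: "p\<^sup>2 = 2 * h" by (simp add: h_def)
  show ?thesis
    unfolding LV Dt\<tau> Ds\<sigma> P k_def[symmetric] h_def[symmetric]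
    using k4 h f_def by algebra
qed

lemma noether_with_gen:
  assumes "admissible c" "\<forall>z\<in>D. X z = sym_field n \<gamma> c z"
  shows "noether_with D L X B1 B2 \<longleftrightarrow> Ck_on 1 D B1 \<and> Ck_on 1 D B2 \<and>
    (\<forall>t s u p q. (t, s, u) \<in> D \<longrightarrow> q > 0 \<longrightarrow>
      (4 - time_weight n \<gamma>) * c 1 * L (t, s, u, p, q) + c 3 * p + c 4 * (u * p)
        = Dt0 B1 (t, s, u, p, q) + Ds0 B2 (t, s, u, p, q))"
proof -
  have "(\<forall>j\<in>jets1 D. prolong1 X L j + L j * (Dt0 (xi_t X) j + Ds0 (xi_s X) j) = Dt0 B1 j + Ds0 B2 j) \<longleftrightarrow>
    (\<forall>t s u p q. (t, s, u, p, q) \<in> jets1 D \<longrightarrow>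
      (4 - time_weight n \<gamma>) * c 1 * L (t, s, u, p, q) + c 3 * p + c 4 * (u * p)
        = Dt0 B1 (t, s, u, p, q) + Ds0 B2 (t, s, u, p, q))"
    using noether_lhs_gen[OF assms] unfolding Ball_def split_paired_All mem_jets1 by metis
  then show ?thesis
    using gen_derivs(1)[OF D assms(2)] unfolding noether_with_def mem_jets1 by blast
qed

text \<open>Since \<open>B1\<close> and \<open>B2\<close> depend on the base point only, the right
  side is affine in p, whereas \<open>L\<close> contains \<open>p\<^sup>2 / 2\<close>. The second
  difference over p = -1, 0, 1 at q = 1 isolates the coefficient of \<open>L\<close>.\<close>

lemma noether_gen_imp:
  assumes c: "admissible c" "\<forall>z\<in>D. X z = sym_field n \<gamma> c z" and N: "noether_with D L X B1 B2"
  shows "time_weight n \<gamma> = 4 \<or> c 1 = 0"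
proof -
  obtain t s u where z: "(t, s, u) \<in> D" using nonempty by auto
  have B: "Ck_on (Suc 0) D B1" "Ck_on (Suc 0) D B2" using N by (auto simp: noether_with_def)
  note b = Ck_on_SucD(1)[OF B(1) z] Ck_on_SucD(1)[OF B(2) z]
  have N': "\<forall>t s u p q. (t, s, u) \<in> D \<longrightarrow> q > 0 \<longrightarrow>
      (4 - time_weight n \<gamma>) * c 1 * L (t, s, u, p, q) + c 3 * p + c 4 * (u * p)
        = Dt0 B1 (t, s, u, p, q) + Ds0 B2 (t, s, u, p, q)"
    using N unfolding noether_with_gen[OF c] by blast
  have "(4 - time_weight n \<gamma>) * c 1 * (p\<^sup>2 / 2 - potential n \<gamma> S (t, s, u, 0, 1)) + c 3 * p + c 4 * (u * p)
      = dt B1 (t, s, u) + p * du B1 (t, s, u) + (ds B2 (t, s, u) + du B2 (t, s, u))" for p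
    using N'[rule_format, OF z zero_less_one, of p] Dt0_eq[OF b(1), of p 1] Ds0_eq[OF b(2), of p 1]
    by (simp del: Dt0.simps Ds0.simps)
  moreover define a where "a = (4 - time_weight n \<gamma>) * c 1"
  ultimately have e: "a * (p\<^sup>2 / 2 - potential n \<gamma> S (t, s, u, 0, 1)) + c 3 * p + c 4 * (u * p)
      = dt B1 (t, s, u) + p * du B1 (t, s, u) + (ds B2 (t, s, u) + du B2 (t, s, u))" for p by blast
  have "a = 0"
    using e[of 0] e[of 1] e[of "-1"] by (simp add: algebra_simps del: potential.simps)
  then show ?thesis by (auto simp: a_def)
qed

text \<open>A single jet with p = q = 1 gives \<open>c 3 + c 4 * u = 0\<close>. In the cases
  considered one summand is already absent: \<open>c 4\<close> if n = 0, and \<open>c 3\<close> if n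
  is nonzero, where moreover u > 0.\<close>

lemma variational_gen_imp:
  assumes c: "admissible c" "\<forall>z\<in>D. X z = sym_field n \<gamma> c z" and N: "variational_symmetry D L X"
    and "n \<noteq> 0 \<or> \<gamma> \<noteq> gamma_star n"
  shows "c 3 = 0" "c 4 = 0"
proof -
  obtain t s u where z: "(t, s, u) \<in> D" using nonempty by auto
  have 1: "(4 - time_weight n \<gamma>) * c 1 = 0"
    using noether_gen_imp[OF c] N by (auto simp: variational_symmetry_def)
  have "(4 - time_weight n \<gamma>) * c 1 * L (t, s, u, 1, 1) + c 3 * 1 + c 4 * (u * 1)
      = Dt0 (\<lambda>_. 0) (t, s, u, 1, 1) + Ds0 (\<lambda>_. 0) (t, s, u, 1, 1)"
    using N[unfolded variational_symmetry_def noether_with_gen[OF c]] z zero_less_one by blast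
  then have 2: "c 3 + c 4 * u = 0" unfolding 1 by simp
  have "c 3 = 0 \<and> c 4 = 0"
  proof (cases "n = 0")
    case True
    then have "c 4 = 0" using assms(4) c(1) unfolding admissible_def by blast
    then show ?thesis using 2 by simp
  next
    case False
    then show ?thesis using 2 c(1) upos'[OF z] by (auto simp: admissible_def)
  qed
  then show "c 3 = 0" "c 4 = 0" by auto
qed

text \<open>Once the multiple of \<open>L\<close> is gone, the remaining terms are the total
  t-derivative of the function given here as first component.\<close>

lemma noether_gen:
  assumes c: "admissible c" "\<forall>z\<in>D. X z = sym_field n \<gamma> c z" and "\<gamma> = gamma_star n \<or> c 1 = 0"
  shows "noether_with D L X (\<lambda>(t, s, u). c 3 * u + c 4 * (u\<^sup>2 / 2)) (\<lambda>_. 0)"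
proof -
  let ?B = "\<lambda>(t::real, s::real, u). c 3 * u + c 4 * (u\<^sup>2 / 2)"
  have B: "(?B has_derivative (\<lambda>v. c 3 * snd (snd v) + c 4 * (snd (snd z) * snd (snd v)))) (at z)" for z
    unfolding case_prod_beta by (auto intro!: derivative_eq_intros)
  have "Ck_on 1 D ?B"
    unfolding One_nat_def by (rule Ck_on_SucI[OF D B]) (auto intro!: continuous_intros)
  moreover have "Dt0 ?B (t, s, u, p, q) = c 3 * p + c 4 * (u * p)" for t s u p q
    by (subst Dt0.simps, subst frechet_derivative_at[OF B, symmetric]) simp
  moreover have "(4 - time_weight n \<gamma>) * c 1 = 0" using assms(3) time_weight_star by auto
  moreover have "Ds0 (\<lambda>_. 0) (t, s, u, p, q) = 0" for t s u p q by simp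
  ultimately show ?thesis
    unfolding noether_with_gen[OF c] by (simp add: Ck_on_const del: Dt0.simps Ds0.simps mult_eq_0_iff)
qed

lemma noether_symmetry_gen:
  "arbitrary_S_symmetry D n \<gamma> X \<and> noether_symmetry D L X \<longleftrightarrow>
    (\<exists>c. (admissible c \<and> (\<gamma> = gamma_star n \<or> c 1 = 0)) \<and> (\<forall>z\<in>D. X z = sym_field n \<gamma> c z))" (is "?l \<longleftrightarrow> ?r")
proof
  assume ?l
  then obtain c B1 B2 where c: "admissible c" "\<forall>z\<in>D. X z = sym_field n \<gamma> c z" and "noether_with D L X B1 B2"
    unfolding arbitrary_S_symmetry_gen noether_symmetry_def by blast
  then show ?r using noether_gen_imp[OF c] time_weight_star by blast
next
  assume ?r
  then show ?l unfolding arbitrary_S_symmetry_gen noether_symmetry_def using noether_gen by blast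
qed

lemma variational_symmetry_gen:
  assumes "n \<noteq> 0 \<or> \<gamma> \<noteq> gamma_star n"
  shows "arbitrary_S_symmetry D n \<gamma> X \<and> variational_symmetry D L X \<longleftrightarrow>
    (\<exists>c. (admissible c \<and> (\<gamma> = gamma_star n \<or> c 1 = 0) \<and> c 3 = 0 \<and> c 4 = 0)
      \<and> (\<forall>z\<in>D. X z = sym_field n \<gamma> c z))" (is "?l \<longleftrightarrow> ?r")
proof
  assume ?l
  then obtain c where c: "admissible c" "\<forall>z\<in>D. X z = sym_field n \<gamma> c z" and v: "variational_symmetry D L X"
    unfolding arbitrary_S_symmetry_gen by blast
  from v have "\<gamma> = gamma_star n \<or> c 1 = 0"
    using noether_gen_imp[OF c] time_weight_star unfolding variational_symmetry_def by blast
  then show ?r using c variational_gen_imp[OF c v assms] by blast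
next
  assume ?r
  then obtain c where c: "admissible c" "\<forall>z\<in>D. X z = sym_field n \<gamma> c z"
    and c': "\<gamma> = gamma_star n \<or> c 1 = 0" "c 3 = 0" "c 4 = 0" by blast
  have "(\<lambda>(t::real, s::real, u). c 3 * u + c 4 * (u\<^sup>2 / 2)) = (\<lambda>_. 0)" by (auto simp: c')
  then have "variational_symmetry D L X"
    using noether_gen[OF c c'(1)] by (simp add: variational_symmetry_def)
  then show ?l using c unfolding arbitrary_S_symmetry_gen by blast
qed

text \<open>\<open>T\<close> states Noether's densities after inserting a zero s-component of the
  field, p for \<open>d_phit L\<close> and the flux for \<open>d_phis L\<close>.\<close>

lemma provides_law_gen:
  assumes c: "admissible c" "\<And>z. X z = sym_field n \<gamma> c z" "\<gamma> = gamma_star n \<or> c 1 = 0"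
    and B: "B1 = (\<lambda>(t, s, u). c 3 * u + c 4 * (u\<^sup>2 / 2))"
    and "conservation_law D F Tt Ts" "k \<noteq> 0"
    and T: "\<And>t s u p q. (t, s, u) \<in> D \<Longrightarrow> q > 0 \<Longrightarrow>
      Tt (t, s, u, p, q) = k * (fst (X (t, s, u)) * L (t, s, u, p, q)
        + (snd (snd (X (t, s, u))) - fst (X (t, s, u)) * p) * p - B1 (t, s, u))"
      "\<And>t s u p q. (t, s, u) \<in> D \<Longrightarrow> q > 0 \<Longrightarrow>
      Ts (t, s, u, p, q) = k * (snd (snd (X (t, s, u))) - fst (X (t, s, u)) * p) * flux n \<gamma> S (t, s, u, p, q)"
  shows "provides_law D L F X B1 (\<lambda>_. 0) Tt Ts"
proof -
  have "Tt j = k * noether_t L X B1 j \<and> Ts j = k * noether_s L X (\<lambda>_. 0) j" if "j \<in> jets1 D" for j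
  proof -
    obtain t s u p q where j: "j = (t, s, u, p, q)" by (cases j)
    have z: "(t, s, u) \<in> D" "q > 0" using that by (auto simp: j mem_jets1)
    have s: "xi_s X (t, s, u) = 0" by (simp add: xi_s_def c(2) sym_field_def)
    show ?thesis
      using d_L(2,3)[OF that[unfolded j]] T[OF z, of p]
      by (simp add: j Let_def s xi_t_def eta_def del: flux.simps lagrangian.simps)
  qed
  then show ?thesis
    unfolding provides_law_def using noether_gen[OF c(1) _ c(3)] assms(5,6) c(2) B by blast
qed

lemma energy_law: "provides_law D L F X_time (\<lambda>_. 0) (\<lambda>_. 0) (energy_t n \<gamma> S) (energy_s n \<gamma> S)"
  by (rule provides_law_gen[where c = "\<lambda>i. if i = 0 then 1 else 0" and k = "-1", OF _ _ _ _ energy_conserved])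
    (auto simp: admissible_def sym_field_def power2_eq_square fun_eq_iff)

lemma momentum_law:
  assumes "n = 0"
  shows "provides_law D L F X_shift (\<lambda>_. 0) (\<lambda>_. 0) momentum_t (momentum_s \<gamma> S)"
proof (rule provides_law_gen[where c = "\<lambda>i. if i = 2 then 1 else 0" and k = 1, OF _ _ _ _ momentum_conserved[OF assms]])
  show "admissible (\<lambda>i. if i = 2 then 1 else 0)" unfolding admissible_def using assms by simp
qed (use assms in \<open>auto simp: sym_field_def power2_eq_square fun_eq_iff phipow_def\<close>)

lemma center_law:
  assumes "n = 0"
  shows "provides_law D L F X_galilei (\<lambda>(t, s, u). u) (\<lambda>_. 0) center_t (center_s \<gamma> S)"
\<comment> \<open>The factor -1 reflects that Noether's formula yields t p - u, the negative of the
  customary density.\<close>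
proof (rule provides_law_gen[where c = "\<lambda>i. if i = 3 then 1 else 0" and k = "-1", OF _ _ _ _ center_conserved[OF assms]])
  show "admissible (\<lambda>i. if i = 3 then 1 else 0)" unfolding admissible_def using assms by simp
qed (use assms in \<open>auto simp: sym_field_def power2_eq_square fun_eq_iff phipow_def\<close>)

lemma X_half_star: "\<gamma> = gamma_star n \<Longrightarrow> X_half n \<gamma> (t, s, u) = (2 * t, 0, u)"
  using time_weight_star[of n \<gamma>] by (simp add: X_half_def time_weight_def)

lemma scaling_law:
  assumes "\<gamma> = gamma_star n"
  shows "provides_law D L F (X_half n \<gamma>) (\<lambda>_. 0) (\<lambda>_. 0) (scaling_t n \<gamma> S) (scaling_s n \<gamma> S)"
proof (rule provides_law_gen[where c = "\<lambda>i. if i = 1 then 1 / 2 else 0" and k = 1, OF _ _ _ _ scaling_conserved[OF assms]])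
  show "X_half n \<gamma> z = sym_field n \<gamma> (\<lambda>i. if i = 1 then 1 / 2 else 0) z" for z
    using time_weight_star[of n \<gamma>] X_half_star[OF assms] assms by (cases z) (simp add: sym_field_def)
  show "admissible (\<lambda>i. if i = 1 then 1 / 2 else 0)" unfolding admissible_def by simp
qed (use assms X_half_star[OF assms] in \<open>auto simp: power2_eq_square fun_eq_iff algebra_simps\<close>)

lemma proj_law:
  assumes "\<gamma> = gamma_star n"
  shows "provides_law D L F X_proj (\<lambda>(t, s, u). u\<^sup>2 / 2) (\<lambda>_. 0) (proj_t n \<gamma> S) (proj_s n \<gamma> S)"
proof (rule provides_law_gen[where c = "\<lambda>i. if i = 4 then 1 else 0" and k = 1, OF _ _ _ _ proj_conserved[OF assms]])
  show "admissible (\<lambda>i. if i = 4 then 1 else 0)" unfolding admissible_def using assms by simp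
qed (use assms in \<open>auto simp: sym_field_def power2_eq_square fun_eq_iff algebra_simps\<close>)

text \<open>\<open>r\<close> translates coefficients of the list \<open>Xs\<close> into those of
  \<open>sym_field\<close>. Surjectivity onto the condition \<open>P\<close> gives spanning,
  injectivity gives independence; agreement is demanded at the indices 0 to 4 because coefficient
  sequences are functions on all naturals.\<close>

lemma basis_on_gen:
  assumes V: "\<And>X. V X \<longleftrightarrow> (\<exists>c. P c \<and> (\<forall>z\<in>D. X z = sym_field n \<gamma> c z))"
    and lin: "\<And>c z. lin_comb c Xs z = sym_field n \<gamma> (r c) z"
    and P: "\<And>c. P (r c)" "\<And>a. P a \<Longrightarrow> \<exists>c. \<forall>i\<in>{0, 1, 2, 3, 4}. r c i = a i"
    and inj: "\<And>c i. r c 0 = 0 \<Longrightarrow> r c 1 = 0 \<Longrightarrow> r c 2 = 0 \<Longrightarrow> r c 3 = 0 \<Longrightarrow> r c 4 = 0 \<Longrightarrow>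
      i < length Xs \<Longrightarrow> c i = 0"
  shows "basis_on D Xs V"
  unfolding basis_on_def lin
proof (intro conjI allI impI)
  fix X
  show "V X \<longleftrightarrow> (\<exists>c. \<forall>z\<in>D. X z = sym_field n \<gamma> (r c) z)"
  proof
    assume "V X"
    then obtain a where a: "P a" "\<forall>z\<in>D. X z = sym_field n \<gamma> a z" using V by blast
    from P(2)[OF a(1)] obtain c where "\<forall>i\<in>{0, 1, 2, 3, 4}. r c i = a i" by blast
    then have "sym_field n \<gamma> (r c) = sym_field n \<gamma> a" by (auto simp: sym_field_def)
    then show "\<exists>c. \<forall>z\<in>D. X z = sym_field n \<gamma> (r c) z" using a(2) by metis
  qed (use V P(1) in blast)
next
  fix c i assume "\<forall>z\<in>D. sym_field n \<gamma> (r c) z = 0" "i < length Xs"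
  then show "c i = 0" using gen_eq_0[OF D nonempty \<gamma>] inj by blast
qed

end

section \<open>Bases and divergent symmetries in the separate cases\<close>

context gas_domain
begin

lemma basis_symmetries: "basis_on D (symmetries n \<gamma>) (arbitrary_S_symmetry D n \<gamma>)"
proof (rule basis_on_gen[OF arbitrary_S_symmetry_gen])
  \<comment> \<open>The position of \<open>X_proj\<close> in the list: for n = 0 it is preceded by
    the shift and the Galilean field.\<close>
  let ?j = "if n = 0 then 4 else 2 :: nat"
  let ?r = "\<lambda>(c :: nat \<Rightarrow> real) (i :: nat). if i = 0 then c 0 else if i = 1 then c 1 else if i = 2 \<and> n = 0 then c 2
    else if i = 3 \<and> n = 0 then c 3 else if i = 4 \<and> \<gamma> = gamma_star n then c ?j else (0 :: real)"
  show "lin_comb c (symmetries n \<gamma>) z = sym_field n \<gamma> (?r c) z" for c z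
    by (cases z) (simp add: lin_comb_def symmetries_def sym_field_def time_weight_def eval_nat_numeral algebra_simps)
  show "admissible (?r c)" for c
    unfolding admissible_def by simp
  show "\<exists>c. \<forall>i\<in>{0, 1, 2, 3, 4}. ?r c i = a i" if "admissible a" for a
    \<comment> \<open>For n = 0 list positions and coefficient indices coincide; otherwise position
      2 holds \<open>X_proj\<close> and receives \<open>a 4\<close>.\<close>
    by (rule exI[of _ "\<lambda>i. if i = 2 \<and> n \<noteq> 0 then a 4 else a i"])
      (use that[unfolded admissible_def] in auto)
  show "c i = 0" if "?r c 0 = 0" "?r c 1 = 0" "?r c 2 = 0" "?r c 3 = 0" "?r c 4 = 0"
    "i < length (symmetries n \<gamma>)" for c i
  proof -
    have "i = 0 \<or> i = 1 \<or> i = 2 \<and> n = 0 \<or> i = 3 \<and> n = 0 \<or> \<gamma> = gamma_star n \<and> i = ?j"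
      using that(6) by (cases "n = 0"; cases "\<gamma> = gamma_star n"; simp add: symmetries_def; presburger)
    then show ?thesis using that(1-5) by (elim disjE conjE) simp_all
  qed
qed

lemma basis_time:
  assumes "n \<noteq> 0" "\<gamma> \<noteq> gamma_star n"
  shows "basis_on D [X_time] (\<lambda>X. arbitrary_S_symmetry D n \<gamma> X \<and> variational_symmetry D L X)"
    and "basis_on D [X_time] (\<lambda>X. arbitrary_S_symmetry D n \<gamma> X \<and> noether_symmetry D L X)"
proof -
  let ?r = "\<lambda>(c :: nat \<Rightarrow> real) (i :: nat). if i = 0 then c 0 else 0 :: real"
  have lin: "lin_comb c [X_time] z = sym_field n \<gamma> (?r c) z" for c z
    by (cases z) (simp add: lin_comb_def sym_field_def)
  have ex: "\<exists>c. \<forall>i\<in>{0, 1, 2, 3, 4}. ?r c i = a i" if "admissible a \<and> (\<gamma> = gamma_star n \<or> a 1 = 0)" for a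
    by (rule exI[of _ a]) (use that[unfolded admissible_def] assms in auto)
  have adm: "admissible (?r c)" for c unfolding admissible_def by simp
  show "basis_on D [X_time] (\<lambda>X. arbitrary_S_symmetry D n \<gamma> X \<and> variational_symmetry D L X)"
    by (rule basis_on_gen[OF variational_symmetry_gen lin]) (use assms adm ex in auto)
  show "basis_on D [X_time] (\<lambda>X. arbitrary_S_symmetry D n \<gamma> X \<and> noether_symmetry D L X)"
    by (rule basis_on_gen[OF noether_symmetry_gen lin]) (use assms adm ex in auto)
qed

lemma basis_time_shift:
  assumes "n = 0" "\<gamma> \<noteq> gamma_star n"
  shows "basis_on D [X_time, X_shift] (\<lambda>X. arbitrary_S_symmetry D n \<gamma> X \<and> variational_symmetry D L X)"
proof -
  let ?r = "\<lambda>(c :: nat \<Rightarrow> real) (i :: nat). if i = 0 then c 0 else if i = 2 then c 1 else 0 :: real"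
  have lin: "lin_comb c [X_time, X_shift] z = sym_field n \<gamma> (?r c) z" for c z
    by (cases z) (simp add: lin_comb_def sym_field_def eval_nat_numeral)
  have ex: "\<exists>c. \<forall>i\<in>{0, 1, 2, 3, 4}. ?r c i = a i"
    if "admissible a \<and> (\<gamma> = gamma_star n \<or> a 1 = 0) \<and> a 3 = 0 \<and> a 4 = 0" for a
    by (rule exI[of _ "\<lambda>i. if i = 1 then a 2 else a i"]) (use that assms(2) in auto)
  have adm: "admissible (?r c)" for c unfolding admissible_def using assms by simp
  show ?thesis
    by (rule basis_on_gen[OF variational_symmetry_gen lin])
      (use assms(2) adm ex in \<open>auto simp: less_Suc_eq numeral_2_eq_2\<close>)
qed

lemma basis_time_shift_galilei:
  assumes "n = 0" "\<gamma> \<noteq> gamma_star n"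
  shows "basis_on D [X_time, X_shift, X_galilei] (\<lambda>X. arbitrary_S_symmetry D n \<gamma> X \<and> noether_symmetry D L X)"
proof -
  let ?r = "\<lambda>(c :: nat \<Rightarrow> real) (i :: nat). if i = 0 then c 0 else if i = 2 then c 1 else if i = 3 then c 2 else 0 :: real"
  have lin: "lin_comb c [X_time, X_shift, X_galilei] z = sym_field n \<gamma> (?r c) z" for c z
    by (cases z) (simp add: lin_comb_def sym_field_def eval_nat_numeral)
  have ex: "\<exists>c. \<forall>i\<in>{0, 1, 2, 3, 4}. ?r c i = a i"
    if "admissible a \<and> (\<gamma> = gamma_star n \<or> a 1 = 0)" for a
    \<comment> \<open>\<open>X_scale\<close> is missing from the list, so the shift and Galilean
      coefficients move down by one position.\<close>
    by (rule exI[of _ "\<lambda>i. if i = 1 then a 2 else if i = 2 then a 3 else a i"])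
      (use that[unfolded admissible_def] assms(2) in auto)
  have adm: "admissible (?r c)" for c unfolding admissible_def using assms by simp
  show ?thesis
    by (rule basis_on_gen[OF noether_symmetry_gen lin])
      (use assms(2) adm ex in \<open>auto simp: less_Suc_eq numeral_2_eq_2\<close>)
qed

lemma lin_comb_star:
  assumes "\<gamma> = gamma_star n"
  shows "lin_comb c [X_time, X_half n \<gamma>] z = sym_field n \<gamma> (\<lambda>i. if i = 0 then c 0 else if i = 1 then c 1 / 2 else 0) z"
    "lin_comb c [X_time, X_half n \<gamma>, X_proj] z
      = sym_field n \<gamma> (\<lambda>i. if i = 0 then c 0 else if i = 1 then c 1 / 2 else if i = 4 then c 2 else 0) z"
  using X_half_star[OF assms] time_weight_star[of n \<gamma>] assms
  by (cases z; simp add: lin_comb_def sym_field_def eval_nat_numeral)+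

lemma basis_star:
  assumes "n \<noteq> 0" "\<gamma> = gamma_star n"
  shows "basis_on D [X_time, X_half n \<gamma>] (\<lambda>X. arbitrary_S_symmetry D n \<gamma> X \<and> variational_symmetry D L X)"
    and "basis_on D [X_time, X_half n \<gamma>, X_proj] (\<lambda>X. arbitrary_S_symmetry D n \<gamma> X \<and> noether_symmetry D L X)"
proof -
  have adm: "admissible (\<lambda>i. if i = 0 then c 0 else if i = 1 then c 1 / 2 else 0)"
    "admissible (\<lambda>i. if i = 0 then c 0 else if i = 1 then c 1 / 2 else if i = 4 then c 2 else 0)" for c :: "nat \<Rightarrow> real"
    unfolding admissible_def using assms(2) by simp_all
  have ex: "\<exists>c :: nat \<Rightarrow> real. \<forall>i\<in>{0, 1, 2, 3, 4}. (if i = 0 then c 0 else if i = 1 then c 1 / 2 else 0) = a i"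
    if "admissible a" "a 3 = 0" "a 4 = 0" for a
    \<comment> \<open>\<open>X_half\<close> is half of \<open>X_scale\<close>, hence its coefficient
      is doubled.\<close>
    by (rule exI[of _ "\<lambda>i. if i = 1 then 2 * a 1 else a i"])
      (use that[unfolded admissible_def] assms(1) in auto)
  have ex': "\<exists>c :: nat \<Rightarrow> real. \<forall>i\<in>{0, 1, 2, 3, 4}. (if i = 0 then c 0 else if i = 1 then c 1 / 2 else if i = 4 then c 2 else 0) = a i"
    if "admissible a" for a
    by (rule exI[of _ "\<lambda>i. if i = 1 then 2 * a 1 else if i = 2 then a 4 else a i"])
      (use that[unfolded admissible_def] assms(1) in auto)
  show "basis_on D [X_time, X_half n \<gamma>] (\<lambda>X. arbitrary_S_symmetry D n \<gamma> X \<and> variational_symmetry D L X)"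
    by (rule basis_on_gen[OF variational_symmetry_gen lin_comb_star(1)[OF assms(2)]])
      (use assms adm(1) ex in \<open>simp_all add: less_Suc_eq, auto?\<close>)
  show "basis_on D [X_time, X_half n \<gamma>, X_proj] (\<lambda>X. arbitrary_S_symmetry D n \<gamma> X \<and> noether_symmetry D L X)"
    by (rule basis_on_gen[OF noether_symmetry_gen lin_comb_star(2)[OF assms(2)]])
      (use assms adm(2) ex' in \<open>simp_all add: less_Suc_eq numeral_2_eq_2, auto?\<close>)
qed

lemma divergent_galilei:
  assumes "n = 0" "\<gamma> \<noteq> gamma_star n"
  shows "divergent_symmetry D L X_galilei"
proof -
  let ?c = "\<lambda>i::nat. if i = 3 then 1 else 0 :: real"
  have c: "admissible ?c" "\<forall>z\<in>D. X_galilei z = sym_field n \<gamma> ?c z"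
    unfolding admissible_def using assms by (auto simp: sym_field_def)
  have "\<not> variational_symmetry D L X_galilei"
    using variational_gen_imp(1)[OF c] assms by auto
  then show ?thesis
    using center_law[OF assms(1)] unfolding divergent_symmetry_def noether_symmetry_def provides_law_def by blast
qed

lemma divergent_proj:
  assumes "n \<noteq> 0" "\<gamma> = gamma_star n"
  shows "divergent_symmetry D L X_proj"
proof -
  let ?c = "\<lambda>i::nat. if i = 4 then 1 else 0 :: real"
  have c: "admissible ?c" "\<forall>z\<in>D. X_proj z = sym_field n \<gamma> ?c z"
    unfolding admissible_def using assms by (auto simp: sym_field_def)
  have "\<not> variational_symmetry D L X_proj"
    using variational_gen_imp(2)[OF c] assms(1) by auto
  then show ?thesis
    using proj_law[OF assms(2)] unfolding divergent_symmetry_def noether_symmetry_def provides_law_def by blast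
qed

end

theorem mainTheorem3:
  fixes n :: nat and \<gamma> :: real and S :: "real \<Rightarrow> real" and D :: "(real \<times> real \<times> real) set"
  assumes "n \<in> {0, 1, 2}" and "\<gamma> > 1"
    and "Ck_on 2 UNIV S"
    and "open D" and "connected D" and "D \<noteq> {}"
    and "n \<noteq> 0 \<Longrightarrow> D \<subseteq> {(t, s, u). u > 0}"
  defines "L \<equiv> lagrangian n \<gamma> S" and "F \<equiv> gas n \<gamma> S" and "zero \<equiv> (\<lambda>_::real \<times> real \<times> real. 0::real)"
  shows
    "(\<forall>j\<in>jets2 D. euler_lagrange L j = 0 \<longleftrightarrow> F j = 0) \<and>
     basis_on D (symmetries n \<gamma>) (arbitrary_S_symmetry D n \<gamma>) \<and>
     (n \<noteq> 0 \<and> \<gamma> \<noteq> gamma_star n \<longrightarrow>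
        basis_on D [X_time] (\<lambda>X. arbitrary_S_symmetry D n \<gamma> X \<and> variational_symmetry D L X) \<and>
        basis_on D [X_time] (\<lambda>X. arbitrary_S_symmetry D n \<gamma> X \<and> noether_symmetry D L X) \<and>
        provides_law D L F X_time zero zero (energy_t n \<gamma> S) (energy_s n \<gamma> S)) \<and>
     (n = 0 \<and> \<gamma> \<noteq> gamma_star n \<longrightarrow>
        basis_on D [X_time, X_shift]
          (\<lambda>X. arbitrary_S_symmetry D n \<gamma> X \<and> variational_symmetry D L X) \<and>
        basis_on D [X_time, X_shift, X_galilei]
          (\<lambda>X. arbitrary_S_symmetry D n \<gamma> X \<and> noether_symmetry D L X) \<and>
        divergent_symmetry D L X_galilei \<and>
        provides_law D L F X_time zero zero (energy_t n \<gamma> S) (energy_s n \<gamma> S) \<and>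
        provides_law D L F X_shift zero zero momentum_t (momentum_s \<gamma> S) \<and>
        provides_law D L F X_galilei (\<lambda>(t, s, u). u) zero center_t (center_s \<gamma> S)) \<and>
     (n \<noteq> 0 \<and> \<gamma> = gamma_star n \<longrightarrow>
        (\<forall>t s u. X_half n \<gamma> (t, s, u) = (2 * t, 0, u)) \<and>
        basis_on D [X_time, X_half n \<gamma>]
          (\<lambda>X. arbitrary_S_symmetry D n \<gamma> X \<and> variational_symmetry D L X) \<and>
        basis_on D [X_time, X_half n \<gamma>, X_proj]
          (\<lambda>X. arbitrary_S_symmetry D n \<gamma> X \<and> noether_symmetry D L X) \<and>
        divergent_symmetry D L X_proj \<and>
        provides_law D L F X_time zero zero (energy_t n \<gamma> S) (energy_s n \<gamma> S) \<and>
        provides_law D L F (X_half n \<gamma>) zero zero (scaling_t n \<gamma> S) (scaling_s n \<gamma> S) \<and>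
        provides_law D L F X_proj (\<lambda>(t, s, u). u\<^sup>2 / 2) zero (proj_t n \<gamma> S) (proj_s n \<gamma> S)) \<and>
     (n = 0 \<and> \<gamma> = gamma_star n \<longrightarrow>
        \<gamma> = 3 \<and>
        provides_law D L F X_time zero zero (energy_t n \<gamma> S) (energy_s n \<gamma> S) \<and>
        provides_law D L F X_shift zero zero momentum_t (momentum_s \<gamma> S) \<and>
        provides_law D L F X_galilei (\<lambda>(t, s, u). u) zero center_t (center_s \<gamma> S) \<and>
        provides_law D L F (X_half n \<gamma>) zero zero (scaling_t n \<gamma> S) (scaling_s n \<gamma> S) \<and>
        provides_law D L F X_proj (\<lambda>(t, s, u). u\<^sup>2 / 2) zero (proj_t n \<gamma> S) (proj_s n \<gamma> S))"
proof -
  interpret gas_domain n \<gamma> S D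
    by unfold_locales (use assms(2-7) in auto)
  have "euler_lagrange L j = 0 \<longleftrightarrow> F j = 0" if "j \<in> jets2 D" for j
  proof -
    obtain t s u p q a b c where j: "j = (t, s, u, p, q, a, b, c)"
      by (cases j; cases "snd (snd (snd (snd (snd (snd j)))))") auto
    show ?thesis using euler_lagrange_eq[OF that[unfolded j]] by (simp only: j L_def F_def neg_equal_0_iff_equal)
  qed
  moreover have "\<gamma> = 3" if "n = 0" "\<gamma> = gamma_star n" using that by (simp add: gamma_star_def)
  ultimately show ?thesis
    unfolding L_def F_def zero_def
    using basis_symmetries basis_time basis_time_shift basis_time_shift_galilei basis_star
      divergent_galilei divergent_proj X_half_star energy_law momentum_law center_law scaling_law proj_law
    by blast
qed

end
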